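(* Let $d\ge1$, $0<\rho<1$, and let $\mathscr{E}=\mathrm{Mat}_d(\mathbb{R})$ or $\mathscr{E}=\mathrm{Sym}_d(\mathbb{R})$. Let $\mathscr{V}\subseteq C^\omega_\rho(\mathbb{T},\mathscr{E})$ denote the subset of analytic potentials with no constant eigenvalues. Then: (a) $\mathscr{V}$ is open and dense in $C^\omega_\rho(\mathbb{T},\mathscr{E})$; (b) the complement of $\mathscr{V}$ in $C^\omega_\rho(\mathbb{T},\mathscr{E})$ is contained in algebraic subvarieties of arbitrarily large codimension in $C^\omega_\rho(\mathbb{T},\mathscr{E})$.
   Context: $\mathbb{T}=\mathbb{R}/\mathbb{Z}$; a function of $x\in\mathbb{T}$ is identified with a function of $z=e^{2\pi i x}$ on the unit circle. $\mathscr{A}_\rho=\{z\in\mathbb{C}:1-\rho\le|z|\le1+\rho\}$. $C^\omega_\rho(\mathbb{T},\mathscr{E})$ is the Banach space of real analytic functions $V:\mathbb{T}\to\mathscr{E}$ having an extension $V(z)$ with values in $\mathscr{E}\otimes\mathbb{C}$, holomorphic in the interior of $\mathscr{A}_\rho$ and continuous on $\mathscr{A}_\rho$, with norm $\|V\|_\rho=\max_{z\in\mathscr{A}_\rho}\|V(z)\|$. $V$ has no constant eigenvalues if there is no $e\in\mathbb{C}$ which is an eigenvalue of $V(x)$ for all $x\in\mathbb{T}$. A (finite codimension) algebraic subvariety of a Banach space $X$ is a subset $\Sigma\subset X$ such that $\Sigma=\pi^{-1}(S)$ for some continuous linear epimorphism $\pi:X\to\mathbb{R}^n$ and some algebraic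 subvariety $S\subset\mathbb{R}^n$; its codimension in $X$ is the codimension of $S$ in $\mathbb{R}^n$. *)

theory Defs
  imports "HOL-Complex_Analysis.Complex_Analysis"
begin

section \<open>The Banach space of analytic matrix-valued functions on the circle\<close>

definition annulus :: "real \<Rightarrow> complex set" where
  "annulus \<rho> = {z. 1 - \<rho> \<le> norm z \<and> norm z \<le> 1 + \<rho>}"

definition holo_extension ::
    "real \<Rightarrow> (real \<Rightarrow> real^'n^'n) \<Rightarrow> (complex \<Rightarrow> complex^'n^'n) \<Rightarrow> bool" where
  "holo_extension \<rho> V W \<longleftrightarrow>
     continuous_on (annulus \<rho>) W \<and>
     (\<forall>i j. (\<lambda>z. W z $ i $ j) holomorphic_on interior (annulus \<rho>)) \<and>
     (\<forall>x. W (exp (2 * of_real pi * \<i> * of_real x)) = map_matrix of_real (V x))"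

definition complexification :: "(real^'n^'n) set \<Rightarrow> (complex^'n^'n) set" where
  "complexification E = {M. map_matrix Re M \<in> E \<and> map_matrix Im M \<in> E}"

text \<open>Functions on \<open>\<real>/\<int>\<close> are 1-periodic functions on \<open>\<real>\<close>. Real analyticity is a consequence of
  the existence of a holomorphic extension to a neighbourhood of the unit circle.\<close>

definition Comega :: "real \<Rightarrow> (real^'n^'n) set \<Rightarrow> (real \<Rightarrow> real^'n^'n) set" where
  "Comega \<rho> E = {V. (\<forall>x. V (x + 1) = V x) \<and> (\<forall>x. V x \<in> E) \<and>
     (\<exists>W. holo_extension \<rho> V W \<and> (\<forall>z\<in>annulus \<rho>. W z \<in> complexification E))}"

text \<open>The extension is unique on the annulus (see \<open>holo_extension_unique\<close>), so the norm does not
  depend on the choice. The matrix norm is the Euclidean one of the library; every other norm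
  on matrices yields the same topology.\<close>

definition Comega_norm :: "real \<Rightarrow> (real \<Rightarrow> real^'n^'n) \<Rightarrow> real" where
  "Comega_norm \<rho> V = (SUP z\<in>annulus \<rho>. norm ((SOME W. holo_extension \<rho> V W) z))"

text \<open>The value off the carrier is irrelevant, but \<open>Metric_space\<close> asks for
  nonnegativity and symmetry everywhere.\<close>

definition Comega_dist ::
    "real \<Rightarrow> (real^'n^'n) set \<Rightarrow> (real \<Rightarrow> real^'n^'n) \<Rightarrow> (real \<Rightarrow> real^'n^'n) \<Rightarrow> real" where
  "Comega_dist \<rho> E V W =
     (if V \<in> Comega \<rho> E \<and> W \<in> Comega \<rho> E then Comega_norm \<rho> (\<lambda>x. V x - W x) else 0)"

definition Comega_topology :: "real \<Rightarrow> (real^'n^'n) set \<Rightarrow> (real \<Rightarrow> real^'n^'n) topology" where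
  "Comega_topology \<rho> E = Metric_space.mtopology (Comega \<rho> E) (Comega_dist \<rho> E)"

definition eigenvalue_of :: "real^'n^'n \<Rightarrow> complex \<Rightarrow> bool" where
  "eigenvalue_of A e \<longleftrightarrow> (\<exists>v::complex^'n. v \<noteq> 0 \<and> map_matrix of_real A *v v = e *s v)"

definition no_constant_eigenvalues :: "(real \<Rightarrow> real^'n^'n) \<Rightarrow> bool" where
  "no_constant_eigenvalues V \<longleftrightarrow> \<not> (\<exists>e. \<forall>x. eigenvalue_of (V x) e)"


section \<open>Algebraic subvarieties and their codimension\<close>

text \<open>As in the library's \<open>Euclidean_space n\<close>, \<open>\<real>\<^sup>n\<close> is the set of real sequences
  vanishing from index \<open>n\<close> on.\<close>

inductive polynomial_fun :: "nat \<Rightarrow> ((nat \<Rightarrow> real) \<Rightarrow> real) \<Rightarrow> bool" for n where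
  const: "polynomial_fun n (\<lambda>x. c)"
| coord: "i < n \<Longrightarrow> polynomial_fun n (\<lambda>x. x i)"
| add: "polynomial_fun n p \<Longrightarrow> polynomial_fun n q \<Longrightarrow> polynomial_fun n (\<lambda>x. p x + q x)"
| mult: "polynomial_fun n p \<Longrightarrow> polynomial_fun n q \<Longrightarrow> polynomial_fun n (\<lambda>x. p x * q x)"

definition algebraic_set :: "nat \<Rightarrow> (nat \<Rightarrow> real) set \<Rightarrow> bool" where
  "algebraic_set n S \<longleftrightarrow>
     (\<exists>P. (\<forall>p\<in>P. polynomial_fun n p) \<and>
          S = {x \<in> topspace (Euclidean_space n). \<forall>p\<in>P. p x = 0})"

definition irreducible_algebraic :: "nat \<Rightarrow> (nat \<Rightarrow> real) set \<Rightarrow> bool" where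
  "irreducible_algebraic n Z \<longleftrightarrow> algebraic_set n Z \<and> Z \<noteq> {} \<and>
     (\<forall>A B. algebraic_set n A \<longrightarrow> algebraic_set n B \<longrightarrow> Z = A \<union> B \<longrightarrow> Z = A \<or> Z = B)"

text \<open>Krull dimension: the supremum of the lengths \<open>l\<close> of chains
  \<open>C 0 \<subset> \<dots> \<subset> C l\<close> of irreducible algebraic subsets of \<open>S\<close>.\<close>

definition algebraic_dim :: "nat \<Rightarrow> (nat \<Rightarrow> real) set \<Rightarrow> enat" where
  "algebraic_dim n S = Sup {enat l | l. \<exists>C :: nat \<Rightarrow> (nat \<Rightarrow> real) set.
     (\<forall>i\<le>l. irreducible_algebraic n (C i) \<and> C i \<subseteq> S) \<and> (\<forall>i<l. C i \<subset> C (Suc i))}"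

definition algebraic_codim :: "nat \<Rightarrow> (nat \<Rightarrow> real) set \<Rightarrow> enat" where
  "algebraic_codim n S = (if S = {} then \<infinity> else enat n - algebraic_dim n S)"

text \<open>Here \<open>X\<close> is a topology whose carrier is a linear space of functions with
  pointwise operations.\<close>

definition linear_epimorphism ::
    "('a \<Rightarrow> 'b::real_vector) topology \<Rightarrow> nat \<Rightarrow> (('a \<Rightarrow> 'b) \<Rightarrow> nat \<Rightarrow> real) \<Rightarrow> bool" where
  "linear_epimorphism X n \<pi> \<longleftrightarrow>
     (\<forall>V\<in>topspace X. \<forall>W\<in>topspace X. \<pi> (\<lambda>x. V x + W x) = (\<lambda>i. \<pi> V i + \<pi> W i)) \<and>
     (\<forall>c. \<forall>V\<in>topspace X. \<pi> (\<lambda>x. c *\<^sub>R V x) = (\<lambda>i. c * \<pi> V i)) \<and>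
     \<pi> ` topspace X = topspace (Euclidean_space n)"

definition algebraic_subvariety_of_codim ::
    "('a \<Rightarrow> 'b::real_vector) topology \<Rightarrow> ('a \<Rightarrow> 'b) set \<Rightarrow> enat \<Rightarrow> bool" where
  "algebraic_subvariety_of_codim X \<Sigma> c \<longleftrightarrow>
     (\<exists>n \<pi> S. linear_epimorphism X n \<pi> \<and> continuous_map X (Euclidean_space n) \<pi> \<and>
        algebraic_set n S \<and> \<Sigma> = {V \<in> topspace X. \<pi> V \<in> S} \<and> c = algebraic_codim n S)"


section \<open>Well-definedness of the norm and of the topology\<close>

lemma interior_annulus:
  assumes "0 < \<rho>" "\<rho> < 1"
  shows "interior (annulus \<rho>) = {z. 1 - \<rho> < norm z \<and> norm z < 1 + \<rho>}"
proof -
  have "annulus \<rho> = cball 0 (1 + \<rho>) \<inter> - ball 0 (1 - \<rho>)"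
    by (auto simp: annulus_def)
  moreover have "interior (- ball (0::complex) (1 - \<rho>)) = - cball 0 (1 - \<rho>)"
    using assms by (simp add: interior_complement)
  ultimately show ?thesis
    by (auto simp: interior_cball)
qed

lemma annulus_subset_closure:
  assumes "0 < \<rho>" "\<rho> < 1"
  shows "annulus \<rho> \<subseteq> closure (interior (annulus \<rho>))"
proof
  fix z assume z: "z \<in> annulus \<rho>"
  define f where "f = (\<lambda>n::nat. (norm z + (1 - norm z) / real (n + 2)) *\<^sub>R sgn z)"
  have nz: "norm z > 0" using z assms by (auto simp: annulus_def)
  have "f n \<in> interior (annulus \<rho>)" for n
  proof -
    define t where "t = 1 / real (n + 2)"
    have t: "0 < t" "t < 1" by (auto simp: t_def)
    have eq: "norm z + (1 - norm z) / real (n + 2) = (1 - t) * norm z + t * 1"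
      by (simp add: t_def algebra_simps diff_divide_distrib add_divide_distrib)
    have a: "1 - \<rho> \<le> norm z" "norm z \<le> 1 + \<rho>" using z by (auto simp: annulus_def)
    have "(1 - t) * (1 - \<rho>) \<le> (1 - t) * norm z" "(1 - t) * norm z \<le> (1 - t) * (1 + \<rho>)"
      using a t by (auto intro!: mult_left_mono)
    moreover have "t * \<rho> > 0" using t assms by simp
    ultimately have b: "1 - \<rho> < (1 - t) * norm z + t * 1" "(1 - t) * norm z + t * 1 < 1 + \<rho>"
      by (simp_all add: algebra_simps)
    have "norm (f n) = (1 - t) * norm z + t * 1"
      using b nz assms by (simp only: f_def eq norm_scaleR norm_sgn) auto
    then show ?thesis using b by (simp add: interior_annulus[OF assms])
  qed
  moreover have "f \<longlonglongrightarrow> (norm z + 0) *\<^sub>R sgn z"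
    unfolding f_def
    by (intro tendsto_intros tendsto_divide_0[OF tendsto_const] filterlim_at_top_imp_at_infinity
        filterlim_compose[OF filterlim_real_sequentially filterlim_add_const_nat_at_top])
  moreover have "(norm z + 0) *\<^sub>R sgn z = z"
    using nz by (simp add: sgn_div_norm)
  ultimately show "z \<in> closure (interior (annulus \<rho>))"
    by (metis closure_sequential)
qed

lemma holo_extension_unique:
  assumes \<rho>: "0 < \<rho>" "\<rho> < 1"
    and W1: "holo_extension \<rho> V W1" and W2: "holo_extension \<rho> V W2" and z: "z \<in> annulus \<rho>"
  shows "W1 z = W2 z"
proof -
  have "W1 z $ i $ j - W2 z $ i $ j = 0" for i j
  proof -
    define f where "f = (\<lambda>z. W1 z $ i $ j - W2 z $ i $ j)"
    let ?I = "interior (annulus \<rho>)"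
    have hol: "f holomorphic_on ?I"
      using W1 W2 unfolding f_def holo_extension_def by (intro holomorphic_on_diff) auto
    have con: "connected ?I"
      using connected_annulus(1)[where a="0::complex" and ?r1.0="1 - \<rho>" and ?r2.0="1 + \<rho>"]
      by (simp add: interior_annulus[OF \<rho>])
    have sph: "f w = 0" if "w \<in> sphere 0 1" for w
    proof -
      have "w = exp (2 * of_real pi * \<i> * of_real (Arg w / (2 * pi)))"
        using that Arg_eq[of w] by (cases "w = 0") (auto simp: mult.commute)
      then show ?thesis
        using W1 W2 unfolding f_def holo_extension_def by (metis diff_self)
    qed
    have lim: "(1::complex) islimpt sphere 0 1"
    proof (rule connected_imp_perfect)
      show "connected (sphere (0::complex) 1)" by (simp add: connected_sphere)
      show "sphere 0 1 \<noteq> {a}" for a :: complex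
      proof
        assume eq: "sphere 0 1 = {a}"
        have "(1::complex) \<in> sphere 0 1" "(-1::complex) \<in> sphere 0 1" by auto
        then show False unfolding eq by auto
      qed
    qed simp
    have sub: "sphere 0 1 \<subseteq> ?I" using \<rho> by (auto simp: interior_annulus[OF \<rho>])
    have "f w = 0" if "w \<in> ?I" for w
      using analytic_continuation[OF hol open_interior con sub _ lim sph that] \<rho>
      by (auto simp: interior_annulus[OF \<rho>])
    moreover have "continuous_on (annulus \<rho>) f"
      using W1 W2 unfolding f_def holo_extension_def by (intro continuous_intros) auto
    moreover have "closed (annulus \<rho>)"
    proof -
      have "annulus \<rho> = cball 0 (1 + \<rho>) - ball 0 (1 - \<rho>)"
        by (auto simp: annulus_def)
      then show ?thesis by (simp add: closed_Diff)
    qed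
    then have "closure ?I = annulus \<rho>"
      using annulus_subset_closure[OF \<rho>] by (meson closure_minimal interior_subset subset_antisym)
    ultimately show ?thesis
      using continuous_constant_on_closure[of ?I f "0::complex" z] z unfolding f_def by auto
  qed
  then show ?thesis by (simp add: vec_eq_iff)
qed

lemma compact_annulus: "compact (annulus \<rho>)"
proof -
  have "annulus \<rho> = cball 0 (1 + \<rho>) - ball 0 (1 - \<rho>)"
    by (auto simp: annulus_def)
  then show ?thesis by (simp add: compact_diff)
qed

lemma Comega_norm_eq:
  assumes "0 < \<rho>" "\<rho> < 1" "holo_extension \<rho> V W"
  shows "Comega_norm \<rho> V = (SUP z\<in>annulus \<rho>. norm (W z))"
proof -
  have "holo_extension \<rho> V (SOME W. holo_extension \<rho> V W)"
    using assms(3) by (metis someI)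
  then show ?thesis
    unfolding Comega_norm_def using holo_extension_unique[OF assms(1,2) _ assms(3)]
    by (intro SUP_cong) auto
qed

lemma norm_extension_le:
  assumes "0 < \<rho>" "\<rho> < 1" "holo_extension \<rho> V W" "z \<in> annulus \<rho>"
  shows "norm (W z) \<le> Comega_norm \<rho> V"
proof -
  have "compact ((\<lambda>z. norm (W z)) ` annulus \<rho>)"
    using assms(3) unfolding holo_extension_def
    by (intro compact_continuous_image compact_annulus continuous_on_norm) auto
  then have "bdd_above ((\<lambda>z. norm (W z)) ` annulus \<rho>)"
    by (simp add: bounded_imp_bdd_above compact_imp_bounded)
  then show ?thesis
    unfolding Comega_norm_eq[OF assms(1-3)] using assms(4) by (rule cSUP_upper2) auto
qed

lemma Comega_norm_le:
  assumes "0 < \<rho>" "\<rho> < 1" "holo_extension \<rho> V W" "\<And>z. z \<in> annulus \<rho> \<Longrightarrow> norm (W z) \<le> B"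
  shows "Comega_norm \<rho> V \<le> B"
proof -
  have "1 \<in> annulus \<rho>" using assms by (auto simp: annulus_def)
  then show ?thesis
    unfolding Comega_norm_eq[OF assms(1-3)] using assms(4) by (intro cSUP_least) auto
qed

lemma holo_extension_diff:
  assumes "holo_extension \<rho> V1 W1" "holo_extension \<rho> V2 W2"
  shows "holo_extension \<rho> (\<lambda>x. V1 x - V2 x) (\<lambda>z. W1 z - W2 z)"
  using assms unfolding holo_extension_def
  by (auto intro!: continuous_intros holomorphic_intros simp: vec_eq_iff)

lemma Metric_space_Comega:
  fixes E :: "(real^'n^'n) set"
  assumes \<rho>: "0 < \<rho>" "\<rho> < 1"
  shows "Metric_space (Comega \<rho> E) (Comega_dist \<rho> E)"
proof -
  define D where "D = (\<lambda>U V :: real \<Rightarrow> real^'n^'n. Comega_norm \<rho> (\<lambda>x. U x - V x))"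
  have one: "1 \<in> annulus \<rho>" using \<rho> by (auto simp: annulus_def)
  have ex: "\<exists>W. holo_extension \<rho> V W" if "V \<in> Comega \<rho> E" for V
    using that by (auto simp: Comega_def)
  have ge0: "0 \<le> D U V" if m: "U \<in> Comega \<rho> E" "V \<in> Comega \<rho> E" for U V
  proof -
    obtain A B where AB: "holo_extension \<rho> U A" "holo_extension \<rho> V B" using ex m by blast
    have "norm (A 1 - B 1) \<le> D U V"
      unfolding D_def by (rule norm_extension_le[OF \<rho> holo_extension_diff[OF AB] one])
    then show ?thesis by (rule order_trans[OF norm_ge_zero])
  qed
  have sym_le: "D U V \<le> D V U" if m: "U \<in> Comega \<rho> E" "V \<in> Comega \<rho> E" for U V
  proof -
    obtain A B where AB: "holo_extension \<rho> U A" "holo_extension \<rho> V B" using ex m by blast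
    show ?thesis
      unfolding D_def
    proof (rule Comega_norm_le[OF \<rho> holo_extension_diff[OF AB]])
      fix z assume z: "z \<in> annulus \<rho>"
      show "norm (A z - B z) \<le> Comega_norm \<rho> (\<lambda>x. V x - U x)"
        using norm_extension_le[OF \<rho> holo_extension_diff[OF AB(2,1)] z] by (simp add: norm_minus_commute)
    qed
  qed
  have tri: "D U W \<le> D U V + D V W"
    if m: "U \<in> Comega \<rho> E" "V \<in> Comega \<rho> E" "W \<in> Comega \<rho> E" for U V W
  proof -
    obtain A B C where AB: "holo_extension \<rho> U A" "holo_extension \<rho> V B" "holo_extension \<rho> W C"
      using ex m by meson
    have "norm (A z - C z) \<le> D U V + D V W" if z: "z \<in> annulus \<rho>" for z
    proof -
      have "norm (A z - C z) \<le> norm (A z - B z) + norm (B z - C z)"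
        using norm_triangle_ineq[of "A z - B z" "B z - C z"] by simp
      also have "\<dots> \<le> D U V + D V W" unfolding D_def
        by (intro add_mono norm_extension_le[OF \<rho> holo_extension_diff[OF AB(1,2)] z]
            norm_extension_le[OF \<rho> holo_extension_diff[OF AB(2,3)] z])
      finally show ?thesis .
    qed
    then show ?thesis
      unfolding D_def by (intro Comega_norm_le[OF \<rho> holo_extension_diff[OF AB(1,3)]])
  qed
  have self: "D U U = 0" if m: "U \<in> Comega \<rho> E" for U
  proof -
    obtain A where A: "holo_extension \<rho> U A" using ex m by blast
    have "D U U \<le> 0"
      unfolding D_def by (rule Comega_norm_le[OF \<rho> holo_extension_diff[OF A A]]) simp
    then show ?thesis using ge0[OF m m] by simp
  qed
  have sep: "U = V" if m: "U \<in> Comega \<rho> E" "V \<in> Comega \<rho> E" "D U V = 0" for U V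
  proof
    fix x
    obtain A B where AB: "holo_extension \<rho> U A" "holo_extension \<rho> V B" using ex m by blast
    let ?z = "exp (2 * of_real pi * \<i> * of_real x)"
    have "norm ?z = 1" by (simp add: norm_exp_eq_Re)
    then have z: "?z \<in> annulus \<rho>" using \<rho> by (auto simp: annulus_def)
    have "norm (A ?z - B ?z) \<le> D U V"
      unfolding D_def by (rule norm_extension_le[OF \<rho> holo_extension_diff[OF AB] z])
    then have "A ?z = B ?z" using m by simp
    then have "map_matrix complex_of_real (U x) = map_matrix of_real (V x)"
      using AB by (metis holo_extension_def)
    then show "U x = V x" by (simp add: vec_eq_iff)
  qed
  have dist: "Comega_dist \<rho> E U V = (if U \<in> Comega \<rho> E \<and> V \<in> Comega \<rho> E then D U V else 0)" for U V
    by (simp add: Comega_dist_def D_def)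
  show ?thesis
    by unfold_locales (auto simp: dist ge0 self sep tri intro: antisym sym_le)
qed

end

theory Submission
  imports Defs
begin

text \<open>A potential with a constant eigenvalue has a common eigenvalue at any two points. Two matrices
  \<open>A\<close>, \<open>B\<close> with a common eigenvalue make the operator \<open>X \<mapsto> X B - A X\<close> singular, and its determinant
  is a monic polynomial in the coordinate of \<open>B\<close> along the identity matrix. Comparing \<open>x\<^sub>0\<close> with
  \<open>x\<^sub>1, \<dots>, x\<^sub>k\<close> gives \<open>k\<close> equations on the values \<open>V x\<^sub>0, \<dots>, V x\<^sub>k\<close>, each monic in a variable of
  its own. Modulo such equations, polynomials of degree at most \<open>D\<close> in each of the other \<open>n - k\<close>
  variables span a space of dimension \<open>O(D\<^bsup>n - k\<^esup>)\<close>. A chain \<open>C\<^sub>0 \<subset> \<dots> \<subset> C\<^sub>l\<close> of irreducible sets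
  yields \<open>l\<close> polynomials, the \<open>i\<close>-th vanishing on \<open>C\<^bsub>i-1\<^esub>\<close> but not on \<open>C\<^sub>i\<close>, whose monomials are
  linearly independent on \<open>C\<^sub>l\<close>; hence \<open>l \<le> n - k\<close>.

  The spectrum of matrices depends continuously on them, which gives openness. For density,
  a perturbation by \<open>t (1 - cos (2 \<pi> x)) / 2\<close> times the identity shifts the spectrum at \<open>1/2\<close> by \<open>t\<close>
  and fixes it at \<open>0\<close>, so only finitely many \<open>t\<close> leave a constant eigenvalue.\<close>

no_notation fps_nth (infixl \<open>$\<close> 75)

section \<open>Characteristic polynomials\<close>

text \<open>One more linear factor turns coefficient \<open>j\<close> into a combination of the old
  coefficients \<open>j\<close> and, for \<open>j > 0\<close>, \<open>j - 1\<close>. The class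
  \<open>Q\<close> of functions of the parameter \<open>x\<close> is abstract so that it can be
  \<open>polynomial_in J\<close> or the trivial predicate.\<close>

lemma prod_linear_coeff:
  fixes m :: "'i \<Rightarrow> 'x \<Rightarrow> real" and \<alpha> :: "'i \<Rightarrow> real"
  assumes const: "\<And>c. Q (\<lambda>x. c)"
    and add: "\<And>f g. Q f \<Longrightarrow> Q g \<Longrightarrow> Q (\<lambda>x. f x + g x)"
    and mult: "\<And>f g. Q f \<Longrightarrow> Q g \<Longrightarrow> Q (\<lambda>x. f x * g x)"
    and "finite S" and m: "\<And>i. i \<in> S \<Longrightarrow> Q (m i)"
  shows "(\<forall>j. Q (\<lambda>x. coeff (\<Prod>i\<in>S. [:m i x, \<alpha> i:]) j)) \<and>
    (\<forall>x. degree (\<Prod>i\<in>S. [:m i x, \<alpha> i:]) \<le> card S \<and>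
      coeff (\<Prod>i\<in>S. [:m i x, \<alpha> i:]) (card S) = (\<Prod>i\<in>S. \<alpha> i))"
  using \<open>finite S\<close> m
proof (induction S rule: finite_induct)
  case empty
  then show ?case using const by (auto simp: coeff_1)
next
  case (insert i S)
  let ?P = "\<lambda>x. \<Prod>i\<in>S. [:m i x, \<alpha> i:]"
  have IH: "Q (\<lambda>x. coeff (?P x) j)" "degree (?P x) \<le> card S"
    "coeff (?P x) (card S) = (\<Prod>i\<in>S. \<alpha> i)" for j x
    using insert by auto
  have c: "coeff ([:m i x, \<alpha> i:] * ?P x) j =
      m i x * coeff (?P x) j + (case j of 0 \<Rightarrow> 0 | Suc j \<Rightarrow> \<alpha> i * coeff (?P x) j)" for j x
    by (cases j) (auto simp: coeff_pCons)
  have "Q (\<lambda>x. coeff ([:m i x, \<alpha> i:] * ?P x) j)" for j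
    unfolding c by (cases j) (auto intro!: add mult const IH insert.prems)
  moreover have "coeff ([:m i x, \<alpha> i:] * ?P x) (Suc (card S)) = \<alpha> i * (\<Prod>i\<in>S. \<alpha> i)" for x
    using IH(2)[of x] IH(3)[of x] unfolding c by (simp add: coeff_eq_0)
  moreover have "degree ([:m i x, \<alpha> i:] * ?P x) \<le> Suc (card S)" for x
  proof -
    have "degree ([:m i x, \<alpha> i:] * ?P x) \<le> degree [:m i x, \<alpha> i:] + degree (?P x)"
      by (rule degree_mult_le)
    also have "\<dots> \<le> Suc (card S)" using IH(2)[of x] by auto
    finally show ?thesis .
  qed
  ultimately show ?case using insert.hyps by simp
qed

text \<open>Each term of the Leibniz formula is a product of factors of degree at most one in
  \<open>t\<close>. Keeping the coefficients inside \<open>Q\<close> controls which variables they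
  involve.\<close>

lemma charpoly_monic:
  fixes M :: "'x \<Rightarrow> real^'m^'m"
  assumes const: "\<And>c. Q (\<lambda>x. c)"
    and add: "\<And>f g. Q f \<Longrightarrow> Q g \<Longrightarrow> Q (\<lambda>x. f x + g x)"
    and mult: "\<And>f g. Q f \<Longrightarrow> Q g \<Longrightarrow> Q (\<lambda>x. f x * g x)"
    and M: "\<And>i j. Q (\<lambda>x. M x $ i $ j)"
  obtains c where "\<And>j. Q (c j)"
    and "\<And>x t. det (t *\<^sub>R mat 1 + M x) = t ^ CARD('m) + (\<Sum>j<CARD('m). c j x * t ^ j)"
proof -
  let ?N = "CARD('m)"
  let ?\<Pi> = "{p. p permutes (UNIV :: 'm set)}"
  \<comment> \<open>\<open>\<alpha> p i\<close> is the coefficient of \<open>t\<close> in the entry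
    at \<open>(i, p i)\<close>.\<close>
  define \<alpha> where "\<alpha> = (\<lambda>(p :: 'm \<Rightarrow> 'm) i. if i = p i then 1 else 0 :: real)"
  define P where "P = (\<lambda>x p. \<Prod>i\<in>UNIV. [:M x $ i $ p i, \<alpha> p i:])"
  define R where "R = (\<lambda>x. \<Sum>p\<in>?\<Pi>. smult (of_int (sign p)) (P x p))"
  have fin: "finite ?\<Pi>" by simp
  have P: "Q (\<lambda>x. coeff (P x p) j)" "degree (P x p) \<le> ?N" "coeff (P x p) ?N = (\<Prod>i\<in>UNIV. \<alpha> p i)" for p x j
    using prod_linear_coeff[of Q UNIV "\<lambda>i x. M x $ i $ p i" "\<alpha> p"] const add mult M
    unfolding P_def by auto
  have sum: "finite A \<Longrightarrow> (\<And>a. a \<in> A \<Longrightarrow> Q (f a)) \<Longrightarrow> Q (\<lambda>x. \<Sum>a\<in>A. f a x)" for A :: "('m \<Rightarrow> 'm) set" and f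
    by (induction A rule: finite_induct) (auto intro: const add)
  have cQ: "Q (\<lambda>x. coeff (R x) j)" for j
    unfolding R_def coeff_sum coeff_smult by (rule sum[OF fin]) (intro mult const P)
  have deg: "degree (R x) \<le> ?N" for x
    unfolding R_def by (intro degree_sum_le fin) (use P(2) degree_smult_le order_trans in blast)
  have lead: "coeff (R x) ?N = 1" for x
  proof -
    \<comment> \<open>The top coefficients assemble to the Leibniz formula of the identity
      matrix.\<close>
    have "coeff (R x) ?N = (\<Sum>p\<in>?\<Pi>. of_int (sign p) * (\<Prod>i\<in>UNIV. \<alpha> p i))"
      unfolding R_def by (simp add: coeff_sum P(3))
    also have "\<dots> = det (mat 1 :: real^'m^'m)"
      unfolding det_def \<alpha>_def mat_def by simp
    finally show ?thesis by simp
  qed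
  have "det (t *\<^sub>R mat 1 + M x) = t ^ ?N + (\<Sum>j<?N. coeff (R x) j * t ^ j)" for x t
  proof -
    have "det (t *\<^sub>R mat 1 + M x) = poly (R x) t"
      unfolding det_def R_def P_def poly_sum poly_smult poly_prod
      by (intro sum.cong refl arg_cong2[where f="(*)"] prod.cong) (auto simp: \<alpha>_def mat_def)
    also have "\<dots> = (\<Sum>j\<le>?N. coeff (R x) j * t ^ j)"
      using deg[of x] unfolding poly_altdef
      by (intro sum.mono_neutral_left) (auto simp: coeff_eq_0)
    finally show ?thesis using lead by (simp add: lessThan_Suc_atMost[symmetric])
  qed
  from that[of "\<lambda>j x. coeff (R x) j", OF cQ this] show thesis .
qed

section \<open>The dimension of an algebraic set with integral variables\<close>

text \<open>Gaussian elimination by induction on the set \<open>A\<close> of equations: an equation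
  with a nonzero coefficient is solved for the unknown \<open>b\<close>, which removes one equation
  and one unknown.\<close>

lemma homogeneous_system_nontrivial:
  fixes c :: "'a \<Rightarrow> 'b \<Rightarrow> real"
  assumes "finite A" "finite I" "card A < card I"
  shows "\<exists>\<kappa>. (\<exists>a\<in>I. \<kappa> a \<noteq> 0) \<and> (\<forall>m\<in>A. (\<Sum>a\<in>I. \<kappa> a * c a m) = 0)"
  using assms
proof (induction A arbitrary: I c rule: finite_induct)
  case empty
  then have "I \<noteq> {}" by auto
  then show ?case by (intro exI[of _ "\<lambda>_. 1"]) auto
next
  case (insert m A)
  show ?case
  proof (cases "\<forall>a\<in>I. c a m = 0")
    case True
    have "card A < card I" using insert by simp
    from insert.IH[OF insert.prems(1) this, of c] show ?thesis using True by auto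
  next
    case False
    then obtain b where b: "b \<in> I" "c b m \<noteq> 0" by auto
    define J where "J = I - {b}"
    have J: "finite J" "I = insert b J" "b \<notin> J" using insert b by (auto simp: J_def)
    then have "card A < card J" using insert by auto
    from insert.IH[OF J(1) this, of "\<lambda>a m'. c a m' - c a m / c b m * c b m'"]
    obtain \<kappa> where k: "\<exists>a\<in>J. \<kappa> a \<noteq> 0"
      "\<And>m'. m' \<in> A \<Longrightarrow> (\<Sum>a\<in>J. \<kappa> a * (c a m' - c a m / c b m * c b m')) = 0" by blast
    \<comment> \<open>\<open>- s\<close> is the value of the unknown \<open>b\<close> forced by
      equation \<open>m\<close>.\<close>
    define s where "s = (\<Sum>a\<in>J. \<kappa> a * c a m / c b m)"
    define \<kappa>' where "\<kappa>' = \<kappa>(b := - s)"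
    have sum: "(\<Sum>a\<in>I. \<kappa>' a * c a m') = (\<Sum>a\<in>J. \<kappa> a * c a m') - s * c b m'" for m'
    proof -
      have "(\<Sum>a\<in>J. \<kappa>' a * c a m') = (\<Sum>a\<in>J. \<kappa> a * c a m')"
        using J by (intro sum.cong) (auto simp: \<kappa>'_def)
      then show ?thesis using J by (simp add: \<kappa>'_def)
    qed
    have "(\<Sum>a\<in>J. \<kappa> a * c a m') - s * c b m' = 0" if "m' \<in> insert m A" for m'
    proof (cases "m' = m")
      case True
      then show ?thesis using b by (simp add: s_def sum_divide_distrib[symmetric])
    next
      case False
      then have "(\<Sum>a\<in>J. \<kappa> a * (c a m' - c a m / c b m * c b m')) = 0" using that k by auto
      then show ?thesis by (simp add: s_def sum_distrib_right sum_subtractf right_diff_distrib mult.assoc)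
    qed
    moreover have "\<exists>a\<in>I. \<kappa>' a \<noteq> 0"
      using k(1) J(2,3) unfolding \<kappa>'_def by (metis fun_upd_other insertI2)
    ultimately show ?thesis unfolding sum[symmetric] by blast
  qed
qed

section \<open>Polynomial functions on irreducible algebraic sets\<close>

lemma polynomial_fun_power: "polynomial_fun n p \<Longrightarrow> polynomial_fun n (\<lambda>x. p x ^ b)"
  by (induction b) (auto intro: polynomial_fun.intros)

lemma polynomial_fun_sum:
  "(\<And>a. a \<in> A \<Longrightarrow> polynomial_fun n (f a)) \<Longrightarrow> polynomial_fun n (\<lambda>x. \<Sum>a\<in>A. f a x)"
  by (induction A rule: infinite_finite_induct) (auto intro: polynomial_fun.intros)

text \<open>Adding \<open>p\<close> or \<open>q\<close> to the equations of \<open>Z\<close> gives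
  two algebraic sets that together cover \<open>Z\<close>. In effect the ideal of \<open>Z\<close>
  is prime, which permits cancelling a factor that does not vanish on all of
  \<open>Z\<close>.\<close>

lemma irreducible_algebraic_prime:
  assumes "irreducible_algebraic n Z" "polynomial_fun n p" "polynomial_fun n q"
    and "\<And>x. x \<in> Z \<Longrightarrow> p x * q x = 0"
  shows "(\<forall>x\<in>Z. p x = 0) \<or> (\<forall>x\<in>Z. q x = 0)"
proof -
  obtain P where P: "\<forall>p\<in>P. polynomial_fun n p" "Z = {x \<in> topspace (Euclidean_space n). \<forall>p\<in>P. p x = 0}"
    using assms(1) unfolding irreducible_algebraic_def algebraic_set_def by blast
  have alg: "algebraic_set n {x \<in> Z. r x = 0}" if "polynomial_fun n r" for r
    unfolding algebraic_set_def by (rule exI[of _ "insert r P"]) (use P that in auto)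
  have "Z = {x \<in> Z. p x = 0} \<union> {x \<in> Z. q x = 0}" using assms(4) by auto
  then have "Z = {x \<in> Z. p x = 0} \<or> Z = {x \<in> Z. q x = 0}"
    using assms(1) alg[OF assms(2)] alg[OF assms(3)] unfolding irreducible_algebraic_def by blast
  then show ?thesis by blast
qed

text \<open>Linear independence after restriction to \<open>Z\<close>, for a family rather than a
  set, so that a repetition counts as a dependence.\<close>

definition independent_family :: "'x set \<Rightarrow> nat \<Rightarrow> (nat \<Rightarrow> 'x \<Rightarrow> real) \<Rightarrow> bool" where
  "independent_family Z q g \<longleftrightarrow>
     (\<forall>\<kappa>. (\<forall>x\<in>Z. (\<Sum>a<q. \<kappa> a * g a x) = 0) \<longrightarrow> (\<forall>a<q. \<kappa> a = 0))"

text \<open>A relation on \<open>Z'\<close> is a polynomial in \<open>f\<close> with coefficients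
  \<open>G b\<close>. Its lowest power of \<open>f\<close> cancels because \<open>Z'\<close> is
  irreducible; on \<open>Z\<close>, where \<open>f\<close> vanishes, only the lowest coefficient is
  then left, and independence on \<open>Z\<close> kills it. The product of \<open>g a\<close> and
  \<open>f ^ b\<close> has number \<open>b * q + a\<close>.\<close>

lemma independent_family_extend:
  assumes irr: "irreducible_algebraic n Z'" and sub: "Z \<subseteq> Z'"
    and f: "polynomial_fun n f" "\<And>x. x \<in> Z \<Longrightarrow> f x = 0" "y \<in> Z'" "f y \<noteq> 0"
    and g: "\<And>a. a < q \<Longrightarrow> polynomial_fun n (g a)" "independent_family Z q g" and q: "q > 0"
  shows "independent_family Z' (r * q) (\<lambda>a x. g (a mod q) x * f x ^ (a div q))"
  unfolding independent_family_def
proof (rule allI, rule impI)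
  fix \<kappa> :: "nat \<Rightarrow> real"
  assume zero: "\<forall>x\<in>Z'. (\<Sum>a<r * q. \<kappa> a * (g (a mod q) x * f x ^ (a div q))) = 0"
  define G where "G = (\<lambda>b x. \<Sum>a<q. \<kappa> (b * q + a) * g a x)"
  have G: "polynomial_fun n (G b)" for b
    unfolding G_def by (intro polynomial_fun_sum polynomial_fun.intros g) auto
  have eq: "(\<Sum>a<r * q. \<kappa> a * (g (a mod q) x * f x ^ (a div q))) = (\<Sum>b<r. G b x * f x ^ b)" for x
  proof -
    have "(\<Sum>a<r * q. \<kappa> a * (g (a mod q) x * f x ^ (a div q))) =
        (\<Sum>b<r. \<Sum>a=b*q..<b*q+q. \<kappa> a * (g (a mod q) x * f x ^ (a div q)))"
      by (rule sum.nat_group[symmetric])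
    also have "\<dots> = (\<Sum>b<r. G b x * f x ^ b)"
    proof (intro sum.cong refl)
      fix b
      have "(\<Sum>a=b*q..<b*q+q. \<kappa> a * (g (a mod q) x * f x ^ (a div q))) =
         (\<Sum>a=0+b*q..<q+b*q. \<kappa> a * (g (a mod q) x * f x ^ (a div q)))" by (simp add: add.commute)
      also have "\<dots> = (\<Sum>a<q. \<kappa> (a + b*q) * (g ((a + b*q) mod q) x * f x ^ ((a + b*q) div q)))"
        unfolding sum.shift_bounds_nat_ivl by (simp add: atLeast0LessThan)
      also have "\<dots> = G b x * f x ^ b"
        unfolding G_def sum_distrib_right using q by (intro sum.cong) (auto simp: add.commute)
      finally show "(\<Sum>a=b*q..<b*q+q. \<kappa> a * (g (a mod q) x * f x ^ (a div q))) = G b x * f x ^ b" .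
    qed
    finally show ?thesis .
  qed
  have key: "\<forall>a<q. \<kappa> (b * q + a) = 0" if "b < r" for b
    using that
  proof (induction b rule: less_induct)
    case (less b)
    have low: "G b' x = 0" if "b' < b" for b' x
      using less.IH[OF that] less.prems that unfolding G_def by auto
    \<comment> \<open>What remains of the relation after cancelling \<open>f ^ b\<close>; the terms
      below \<open>b\<close> are zero by induction.\<close>
    define H where "H = (\<lambda>x. \<Sum>b'=b..<r. G b' x * f x ^ (b' - b))"
    have "f x ^ b * H x = 0" if x: "x \<in> Z'" for x
    proof -
      have "0 = (\<Sum>b'<r. G b' x * f x ^ b')" using zero x unfolding eq by simp
      also have "\<dots> = (\<Sum>b'=b..<r. G b' x * f x ^ b')"
        by (rule sum.mono_neutral_right) (auto simp: low)
      also have "\<dots> = f x ^ b * H x" unfolding H_def sum_distrib_left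
        by (intro sum.cong) (auto simp: power_add[symmetric] ac_simps)
      finally show ?thesis by simp
    qed
    moreover have "polynomial_fun n H" unfolding H_def
      by (intro polynomial_fun_sum polynomial_fun.intros polynomial_fun_power f G)
    ultimately have "(\<forall>x\<in>Z'. f x ^ b = 0) \<or> (\<forall>x\<in>Z'. H x = 0)"
      by (intro irreducible_algebraic_prime[OF irr] polynomial_fun_power f) auto
    \<comment> \<open>The point \<open>y\<close> rules out that \<open>f ^ b\<close> vanishes on
      \<open>Z'\<close>.\<close>
    then have H: "\<forall>x\<in>Z'. H x = 0" using f(3,4) by auto
    have "G b x = 0" if x: "x \<in> Z" for x
    proof -
      have "H x = G b x"
        unfolding H_def using less.prems f(2)[OF x]
        by (subst sum.atLeast_Suc_lessThan) (auto intro!: sum.neutral)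
      then show ?thesis using H x sub by auto
    qed
    then have "\<forall>x\<in>Z. (\<Sum>a<q. \<kappa> (b * q + a) * g a x) = 0" by (simp add: G_def)
    then show ?case
      using g(2)[unfolded independent_family_def, THEN spec, of "\<lambda>a. \<kappa> (b * q + a)"] by (rule rev_mp)
  qed
  show "\<forall>a<r * q. \<kappa> a = 0"
  proof (intro allI impI)
    fix a assume "a < r * q"
    then have "a div q < r" by (simp add: less_mult_imp_div_less)
    from key[OF this] show "\<kappa> a = 0" using q by (metis div_mult_mod_eq mod_less_divisor)
  qed
qed

section \<open>Polynomials modulo monic equations\<close>

text \<open>The coefficients of a monic equation must avoid all variables that are reduced by such
  equations, hence a version of \<open>polynomial_fun\<close> for a chosen set of variables.\<close>

inductive polynomial_in :: "nat set \<Rightarrow> ((nat \<Rightarrow> real) \<Rightarrow> real) \<Rightarrow> bool" for J where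
  const: "polynomial_in J (\<lambda>x. c)"
| coord: "i \<in> J \<Longrightarrow> polynomial_in J (\<lambda>x. x i)"
| add: "polynomial_in J p \<Longrightarrow> polynomial_in J q \<Longrightarrow> polynomial_in J (\<lambda>x. p x + q x)"
| mult: "polynomial_in J p \<Longrightarrow> polynomial_in J q \<Longrightarrow> polynomial_in J (\<lambda>x. p x * q x)"

lemma polynomial_in_imp_polynomial_fun:
  "polynomial_in J p \<Longrightarrow> J \<subseteq> {..<n} \<Longrightarrow> polynomial_fun n p"
  by (induction rule: polynomial_in.induct) (auto intro: polynomial_fun.intros)

lemma polynomial_in_sum:
  "(\<And>a. a \<in> A \<Longrightarrow> polynomial_in J (f a)) \<Longrightarrow> polynomial_in J (\<lambda>x. \<Sum>a\<in>A. f a x)"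
  by (induction A rule: infinite_finite_induct) (auto intro: polynomial_in.intros)

lemma polynomial_in_diff:
  assumes "polynomial_in J p" "polynomial_in J q"
  shows "polynomial_in J (\<lambda>x. p x - q x)"
  using polynomial_in.add[OF assms(1) polynomial_in.mult[OF polynomial_in.const[of J "-1"] assms(2)]]
  by simp

text \<open>\<open>Y\<close> is a set of variables each of which satisfies on \<open>S\<close> a monic equation of degree \<open>e\<close> over
  the polynomials in the remaining variables. \<open>reduced D\<close> consists of the functions agreeing on
  \<open>S\<close> with a polynomial of degree less than \<open>e\<close> in the variables in \<open>Y\<close> and at most \<open>D\<close> in
  each of the others.\<close>

locale integral_variables =
  fixes n e :: nat and Y :: "nat set" and S :: "(nat \<Rightarrow> real) set"
    and c :: "nat \<Rightarrow> nat \<Rightarrow> (nat \<Rightarrow> real) \<Rightarrow> real"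
  assumes e: "e > 0" and Y: "Y \<subseteq> {..<n}"
    and monic: "\<And>i x. i \<in> Y \<Longrightarrow> x \<in> S \<Longrightarrow> x i ^ e + (\<Sum>j<e. c i j x * x i ^ j) = 0"
    and coeffs: "\<And>i j. i \<in> Y \<Longrightarrow> j < e \<Longrightarrow> polynomial_in ({..<n} - Y) (c i j)"
begin

text \<open>\<open>PiE\<close> fixes the values outside \<open>{..<n}\<close> to
  \<open>undefined\<close>, so that the set is finite and can be counted.\<close>

definition exponents :: "nat \<Rightarrow> (nat \<Rightarrow> nat) set" where
  "exponents D = (\<Pi>\<^sub>E i\<in>{..<n}. if i \<in> Y then {..<e} else {..D})"

definition monomial :: "(nat \<Rightarrow> nat) \<Rightarrow> (nat \<Rightarrow> real) \<Rightarrow> real" where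
  "monomial a x = (\<Prod>i<n. x i ^ a i)"

definition reduced :: "nat \<Rightarrow> ((nat \<Rightarrow> real) \<Rightarrow> real) set" where
  "reduced D = {f. \<exists>u. \<forall>x\<in>S. f x = (\<Sum>a\<in>exponents D. u a * monomial a x)}"

text \<open>\<open>\<delta>\<close> depends on \<open>p\<close> but not on \<open>D\<close>, so the
  degree bound grows only linearly with the number of factors \<open>p\<close>.\<close>

definition bounded_mult :: "((nat \<Rightarrow> real) \<Rightarrow> real) \<Rightarrow> bool" where
  "bounded_mult p \<longleftrightarrow> (\<exists>\<delta>. \<forall>D. \<forall>f\<in>reduced D. (\<lambda>x. p x * f x) \<in> reduced (D + \<delta>))"

lemma finite_exponents: "finite (exponents D)"
  unfolding exponents_def by (intro finite_PiE) auto

text \<open>As a function of \<open>D\<close> this has degree \<open>n - card Y\<close>, which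
  becomes the bound on the dimension.\<close>

lemma card_exponents: "card (exponents D) = e ^ card Y * (D + 1) ^ (n - card Y)"
proof -
  have "card (exponents D) = (\<Prod>i<n. if i \<in> Y then e else D + 1)"
    unfolding exponents_def by (subst card_PiE) (auto intro!: prod.cong)
  also have "\<dots> = e ^ card ({..<n} \<inter> Y) * (D + 1) ^ card ({..<n} \<inter> - Y)"
    by (subst prod.If_cases) auto
  also have "{..<n} \<inter> Y = Y" using Y by auto
  also have "card ({..<n} \<inter> - Y) = n - card Y"
    using Y by (metis Diff_eq card_Diff_subset card_lessThan finite_lessThan finite_subset)
  finally show ?thesis .
qed

lemma exponents_mono: "D \<le> D' \<Longrightarrow> exponents D \<subseteq> exponents D'"
  unfolding exponents_def by (intro PiE_mono) auto

lemma reduced_cong: "f \<in> reduced D \<Longrightarrow> (\<And>x. x \<in> S \<Longrightarrow> g x = f x) \<Longrightarrow> g \<in> reduced D"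
  by (auto simp: reduced_def)

lemma monomial_reduced: "a \<in> exponents D \<Longrightarrow> monomial a \<in> reduced D"
  unfolding reduced_def using finite_exponents
  by (intro CollectI exI[of _ "\<lambda>b. if b = a then 1 else 0"]) (auto simp: if_distrib[of "\<lambda>u. u * _"] cong: if_cong)

lemma reduced_add: "f \<in> reduced D \<Longrightarrow> g \<in> reduced D \<Longrightarrow> (\<lambda>x. f x + g x) \<in> reduced D"
proof -
  assume "f \<in> reduced D" "g \<in> reduced D"
  then obtain u v where "\<forall>x\<in>S. f x = (\<Sum>a\<in>exponents D. u a * monomial a x)"
    "\<forall>x\<in>S. g x = (\<Sum>a\<in>exponents D. v a * monomial a x)" by (auto simp: reduced_def)
  then show ?thesis unfolding reduced_def
    by (intro CollectI exI[of _ "\<lambda>a. u a + v a"]) (auto simp: distrib_right sum.distrib)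
qed

lemma reduced_scale: "f \<in> reduced D \<Longrightarrow> (\<lambda>x. r * f x) \<in> reduced D"
proof -
  assume "f \<in> reduced D"
  then obtain u where "\<forall>x\<in>S. f x = (\<Sum>a\<in>exponents D. u a * monomial a x)" by (auto simp: reduced_def)
  then show ?thesis unfolding reduced_def
    by (intro CollectI exI[of _ "\<lambda>a. r * u a"]) (auto simp: sum_distrib_left mult.assoc)
qed

lemma reduced_sum:
  "(\<And>a. a \<in> A \<Longrightarrow> f a \<in> reduced D) \<Longrightarrow> (\<lambda>x. \<Sum>a\<in>A. f a x) \<in> reduced D"
proof (induction A rule: infinite_finite_induct)
  case (insert a A)
  then show ?case by (auto intro: reduced_add)
qed (auto simp: reduced_def intro!: exI[of _ "\<lambda>_. 0"])

lemma reduced_mono: "f \<in> reduced D \<Longrightarrow> D \<le> D' \<Longrightarrow> f \<in> reduced D'"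
proof -
  assume "f \<in> reduced D" "D \<le> D'"
  then obtain u where u: "\<forall>x\<in>S. f x = (\<Sum>a\<in>exponents D. u a * monomial a x)" by (auto simp: reduced_def)
  have "(\<lambda>x. \<Sum>a\<in>exponents D. u a * monomial a x) \<in> reduced D'"
    using exponents_mono[OF \<open>D \<le> D'\<close>] by (intro reduced_sum reduced_scale monomial_reduced) auto
  then show ?thesis by (rule reduced_cong) (use u in auto)
qed

text \<open>By linearity, multiplication needs to be checked on monomials only.\<close>

lemma bounded_multI:
  assumes "\<And>D a. a \<in> exponents D \<Longrightarrow> (\<lambda>x. p x * monomial a x) \<in> reduced (D + \<delta>)"
  shows "bounded_mult p"
  unfolding bounded_mult_def
proof (intro exI allI ballI)
  fix D f assume "f \<in> reduced D"
  then obtain u where u: "\<forall>x\<in>S. f x = (\<Sum>a\<in>exponents D. u a * monomial a x)" by (auto simp: reduced_def)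
  have "(\<lambda>x. \<Sum>a\<in>exponents D. u a * (p x * monomial a x)) \<in> reduced (D + \<delta>)"
    by (intro reduced_sum reduced_scale assms)
  then show "(\<lambda>x. p x * f x) \<in> reduced (D + \<delta>)"
    by (rule reduced_cong) (use u in \<open>auto simp: sum_distrib_left ac_simps\<close>)
qed

lemma bounded_mult_const: "bounded_mult (\<lambda>x. r)"
  unfolding bounded_mult_def by (intro exI[of _ 0]) (auto intro: reduced_scale)

lemma bounded_mult_add:
  assumes "bounded_mult p" "bounded_mult q"
  shows "bounded_mult (\<lambda>x. p x + q x)"
proof -
  obtain \<delta> \<epsilon> where "\<And>D f. f \<in> reduced D \<Longrightarrow> (\<lambda>x. p x * f x) \<in> reduced (D + \<delta>)"
    "\<And>D f. f \<in> reduced D \<Longrightarrow> (\<lambda>x. q x * f x) \<in> reduced (D + \<epsilon>)"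
    using assms unfolding bounded_mult_def by meson
  then show ?thesis unfolding bounded_mult_def distrib_right
    by (intro exI[of _ "\<delta> + \<epsilon>"] allI ballI reduced_add)
      (blast intro: reduced_mono le_add1 le_add2 add_left_mono)+
qed

lemma bounded_mult_mult:
  assumes "bounded_mult p" "bounded_mult q"
  shows "bounded_mult (\<lambda>x. p x * q x)"
proof -
  obtain \<delta> \<epsilon> where "\<And>D f. f \<in> reduced D \<Longrightarrow> (\<lambda>x. p x * f x) \<in> reduced (D + \<delta>)"
    "\<And>D f. f \<in> reduced D \<Longrightarrow> (\<lambda>x. q x * f x) \<in> reduced (D + \<epsilon>)"
    using assms unfolding bounded_mult_def by meson
  then show ?thesis unfolding bounded_mult_def mult.assoc
    by (intro exI[of _ "\<epsilon> + \<delta>"] allI ballI) (simp add: add.assoc[symmetric])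
qed

lemma monomial_upd:
  assumes "i < n"
  shows "monomial (a(i := j)) x = x i ^ j * monomial (a(i := 0)) x"
proof -
  have "monomial (a(i := k)) x = x i ^ k * (\<Prod>l\<in>{..<n} - {i}. x l ^ a l)" for k
    unfolding monomial_def using assms by (subst prod.remove[of _ i]) (auto intro!: prod.cong)
  from this[of j] this[of 0] show ?thesis by simp
qed

lemma monomial_split: "i < n \<Longrightarrow> monomial a x = x i ^ a i * monomial (a(i := 0)) x"
  using monomial_upd[of i a "a i" x] by simp

lemma bounded_mult_other:
  assumes "i \<in> {..<n} - Y"
  shows "bounded_mult (\<lambda>x. x i)"
proof (rule bounded_multI[where \<delta> = 1])
  fix D a assume a: "a \<in> exponents D"
  have "a(i := Suc (a i)) \<in> exponents (D + 1)"
    using a assms unfolding exponents_def PiE_def Pi_def extensional_def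
    by (fastforce split: if_splits)
  from monomial_reduced[OF this] show "(\<lambda>x. x i * monomial a x) \<in> reduced (D + 1)"
    by (rule reduced_cong) (use assms in \<open>simp add: monomial_upd[of i a "Suc (a i)"] monomial_split[of i a]\<close>)
qed

text \<open>Raising the exponent of \<open>x i\<close> is harmless below \<open>e - 1\<close>; at
  \<open>e - 1\<close> the monic equation replaces \<open>x i ^ e\<close> by lower powers. Its
  coefficients involve only variables outside \<open>Y\<close>, for which boundedness is already
  known, so the reduction is not circular.\<close>

lemma bounded_mult_special:
  assumes i: "i \<in> Y"
  shows "bounded_mult (\<lambda>x. x i)"
proof -
  have n: "i < n" using i Y by auto
  have "bounded_mult (c i j)" if "j < e" for j
    using coeffs[OF i that]
    by (induction rule: polynomial_in.induct)
      (auto intro: bounded_mult_const bounded_mult_other bounded_mult_add bounded_mult_mult)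
  then obtain \<delta> where \<delta>: "\<And>j D f. j < e \<Longrightarrow> f \<in> reduced D \<Longrightarrow> (\<lambda>x. c i j x * f x) \<in> reduced (D + \<delta> j)"
    unfolding bounded_mult_def by metis
  \<comment> \<open>The sum is a convenient common upper bound for the finitely many
    \<open>\<delta> j\<close>.\<close>
  define \<epsilon> where "\<epsilon> = (\<Sum>j<e. \<delta> j)"
  have le: "\<delta> j \<le> \<epsilon>" if "j < e" for j
    unfolding \<epsilon>_def using that by (intro member_le_sum) auto
  show ?thesis
  proof (rule bounded_multI[where \<delta> = \<epsilon>])
    fix D a assume a: "a \<in> exponents D"
    have upd: "a(i := j) \<in> exponents D" if "j < e" for j
      using a i n that unfolding exponents_def PiE_def Pi_def extensional_def
      by (fastforce split: if_splits)
    show "(\<lambda>x. x i * monomial a x) \<in> reduced (D + \<epsilon>)"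
    proof (cases "Suc (a i) < e")
      case True
      from reduced_mono[OF monomial_reduced[OF upd[OF this]], of "D + \<epsilon>"] show ?thesis
        by (rule reduced_cong[OF _]) (use n in \<open>simp_all add: monomial_upd[of i a "Suc (a i)"] monomial_split[of i a]\<close>)
    next
      case False
      have "a i < e" using a i n unfolding exponents_def by (auto dest!: PiE_mem[of a _ _ i])
      then have ai: "e = Suc (a i)" using False by simp
      have "(\<lambda>x. (-1) * (\<Sum>j<e. c i j x * monomial (a(i := j)) x)) \<in> reduced (D + \<epsilon>)"
        by (intro reduced_scale reduced_sum)
          (blast intro: reduced_mono \<delta> monomial_reduced upd le add_left_mono)
      then show ?thesis
      proof (rule reduced_cong)
        fix x assume x: "x \<in> S"
        define r where "r = monomial (a(i := 0)) x"
        have r: "monomial (a(i := j)) x = x i ^ j * r" for j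
          unfolding r_def by (rule monomial_upd[OF n])
        have "x i * monomial a x = x i ^ e * r"
          using r[of "a i"] by (simp add: ai)
        also have "x i ^ e = - (\<Sum>j<e. c i j x * x i ^ j)"
          using monic[OF i x] by (simp only: eq_neg_iff_add_eq_0)
        also have "\<dots> * r = (-1) * (\<Sum>j<e. c i j x * monomial (a(i := j)) x)"
          by (simp add: r sum_distrib_right mult.assoc)
        finally show "x i * monomial a x = (-1) * (\<Sum>j<e. c i j x * monomial (a(i := j)) x)" .
      qed
    qed
  qed
qed

lemma bounded_mult_polynomial: "polynomial_fun n p \<Longrightarrow> bounded_mult p"
proof (induction rule: polynomial_fun.induct)
  case (coord i)
  then show ?case by (cases "i \<in> Y") (auto intro: bounded_mult_special bounded_mult_other)
qed (auto intro: bounded_mult_const bounded_mult_add bounded_mult_mult)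

lemma one_reduced: "(\<lambda>x. 1) \<in> reduced 0"
proof -
  have "(\<lambda>i\<in>{..<n}. 0) \<in> exponents 0" using e by (auto simp: exponents_def)
  from monomial_reduced[OF this] show ?thesis by (rule reduced_cong) (simp add: monomial_def)
qed

section \<open>Chains of irreducible sets and the dimension bound\<close>

text \<open>At each step of the chain the family is multiplied by the powers
  \<open>f ^ 0, ..., f ^ D\<close> of a polynomial vanishing on the smaller set but not on the
  larger one. A single \<open>\<delta>\<close> serves all \<open>D\<close>, as the comparison of
  growth rates requires.\<close>

lemma independent_family_chain:
  assumes "\<And>i. i \<le> l \<Longrightarrow> irreducible_algebraic n (C i)" "\<And>i. i < l \<Longrightarrow> C i \<subset> C (Suc i)"
  shows "\<exists>\<delta>. \<forall>D. \<exists>g. (\<forall>a < (D + 1) ^ l. polynomial_fun n (g a) \<and> g a \<in> reduced (\<delta> * D)) \<and>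
     independent_family (C l) ((D + 1) ^ l) g"
  using assms
proof (induction l)
  case 0
  have "C 0 \<noteq> {}" using 0 by (auto simp: irreducible_algebraic_def)
  then show ?case using one_reduced
    by (intro exI[of _ 0] allI exI[of _ "\<lambda>_ _. 1"])
      (auto simp: independent_family_def intro: polynomial_fun.intros)
next
  case (Suc l)
  obtain \<delta> where \<delta>: "\<And>D. \<exists>g. (\<forall>a < (D + 1) ^ l. polynomial_fun n (g a) \<and> g a \<in> reduced (\<delta> * D)) \<and>
     independent_family (C l) ((D + 1) ^ l) g" using Suc by (metis le_SucI less_SucI)
  have sub: "C l \<subset> C (Suc l)" using Suc.prems by simp
  have irr: "irreducible_algebraic n (C l)" "irreducible_algebraic n (C (Suc l))"
    using Suc.prems(1)[of l] Suc.prems(1)[of "Suc l"] by auto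
  obtain y where y: "y \<in> C (Suc l)" "y \<notin> C l" using sub by auto
  obtain P where P: "\<forall>p\<in>P. polynomial_fun n p" "C l = {x \<in> topspace (Euclidean_space n). \<forall>p\<in>P. p x = 0}"
    using irr(1) unfolding irreducible_algebraic_def algebraic_set_def by (elim conjE exE)
  have "algebraic_set n (C (Suc l))" using irr(2) unfolding irreducible_algebraic_def by simp
  then have "y \<in> topspace (Euclidean_space n)" using y(1) unfolding algebraic_set_def by auto
  then obtain f where f: "polynomial_fun n f" "f y \<noteq> 0" "\<And>x. x \<in> C l \<Longrightarrow> f x = 0"
    using y(2) P by auto
  obtain \<epsilon> where \<epsilon>: "\<And>D h. h \<in> reduced D \<Longrightarrow> (\<lambda>x. f x * h x) \<in> reduced (D + \<epsilon>)"
    using bounded_mult_polynomial[OF f(1)] unfolding bounded_mult_def by meson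
  have pow: "(\<lambda>x. h x * f x ^ b) \<in> reduced (D + \<epsilon> * b)" if "h \<in> reduced D" for h b D
  proof (induction b)
    case 0
    then show ?case using that by simp
  next
    case (Suc b)
    from \<epsilon>[OF this] show ?case by (simp add: ac_simps)
  qed
  show ?case
  \<comment> \<open>An old member costs \<open>\<delta> * D\<close>, and a power of \<open>f\<close>
    with exponent at most \<open>D\<close> costs at most \<open>\<epsilon> * D\<close>.\<close>
  proof (intro exI[of _ "\<delta> + \<epsilon>"] allI)
    fix D :: nat
    define q where "q = (D + 1) ^ l"
    obtain g where g: "\<And>a. a < q \<Longrightarrow> polynomial_fun n (g a)" "\<And>a. a < q \<Longrightarrow> g a \<in> reduced (\<delta> * D)"
      "independent_family (C l) q g" using \<delta> unfolding q_def by meson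
    have q: "q > 0" by (simp add: q_def)
    let ?g = "\<lambda>a x. g (a mod q) x * f x ^ (a div q)"
    have eq: "(D + 1) ^ Suc l = (D + 1) * q" by (simp add: q_def)
    have "independent_family (C (Suc l)) ((D + 1) * q) ?g"
      by (rule independent_family_extend[OF irr(2) _ f(1) f(3) y(1) f(2) g(1,3) q]) (use sub in auto)
    moreover have "?g a \<in> reduced ((\<delta> + \<epsilon>) * D)" if "a < (D + 1) * q" for a
    proof -
      have "a div q \<le> D" using that less_mult_imp_div_less[of a "D + 1" q] by simp
      then have "\<delta> * D + \<epsilon> * (a div q) \<le> (\<delta> + \<epsilon>) * D" by (simp add: distrib_right)
      then show ?thesis using reduced_mono pow g(2) q mod_less_divisor by blast
    qed
    moreover have "polynomial_fun n (?g a)" for a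
      using q by (intro polynomial_fun.mult polynomial_fun_power f(1) g(1)) simp
    ultimately show "\<exists>g. (\<forall>a < (D + 1) ^ Suc l. polynomial_fun n (g a) \<and> g a \<in> reduced ((\<delta> + \<epsilon>) * D)) \<and>
     independent_family (C (Suc l)) ((D + 1) ^ Suc l) g"
      unfolding eq by (intro exI[of _ ?g]) blast
  qed
qed

text \<open>The \<open>(D + 1) ^ l\<close> functions, independent on a subset of \<open>S\<close>,
  lie in the span of \<open>e ^ card Y * (\<delta> * D + 1) ^ (n - card Y)\<close> monomials. If
  \<open>l > n - card Y\<close>, this is impossible for a suitable \<open>D\<close>.\<close>

lemma chain_length_le:
  assumes "\<And>i. i \<le> l \<Longrightarrow> irreducible_algebraic n (C i)" "\<And>i. i < l \<Longrightarrow> C i \<subset> C (Suc i)" "C l \<subseteq> S"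
  shows "l \<le> n - card Y"
proof (rule ccontr)
  assume not: "\<not> l \<le> n - card Y"
  define m where "m = n - card Y"
  obtain \<delta> where \<delta>: "\<And>D. \<exists>g. (\<forall>a < (D + 1) ^ l. polynomial_fun n (g a) \<and> g a \<in> reduced (\<delta> * D)) \<and>
     independent_family (C l) ((D + 1) ^ l) g" using independent_family_chain[of l C, OF assms(1,2)] by meson
  have bound: "(D + 1) ^ l \<le> e ^ card Y * (\<delta> * D + 1) ^ m" for D
  proof (rule ccontr)
    assume less: "\<not> (D + 1) ^ l \<le> e ^ card Y * (\<delta> * D + 1) ^ m"
    define q where "q = (D + 1) ^ l"
    obtain g where g: "\<And>a. a < q \<Longrightarrow> g a \<in> reduced (\<delta> * D)"
      "independent_family (C l) q g" using \<delta> unfolding q_def by meson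
    obtain u where u: "\<And>a x. a < q \<Longrightarrow> x \<in> S \<Longrightarrow> g a x = (\<Sum>b\<in>exponents (\<delta> * D). u a b * monomial b x)"
      using g(1) unfolding reduced_def by (simp only: mem_Collect_eq) metis
    have "card (exponents (\<delta> * D)) < card {..<q}"
      using less unfolding card_exponents m_def q_def by simp
    \<comment> \<open>With more functions than monomials, the coefficient vectors \<open>u a\<close>
      are dependent, hence so are the functions on \<open>S\<close>.\<close>
    from homogeneous_system_nontrivial[OF finite_exponents finite_lessThan this, of u]
    obtain \<kappa> where k: "\<exists>a<q. \<kappa> a \<noteq> 0" "\<And>b. b \<in> exponents (\<delta> * D) \<Longrightarrow> (\<Sum>a<q. \<kappa> a * u a b) = 0"
      by auto
    have "(\<Sum>a<q. \<kappa> a * g a x) = 0" if x: "x \<in> C l" for x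
    proof -
      have "(\<Sum>a<q. \<kappa> a * g a x) = (\<Sum>a<q. \<Sum>b\<in>exponents (\<delta> * D). \<kappa> a * u a b * monomial b x)"
        using x assms(3) by (intro sum.cong) (auto simp: u sum_distrib_left mult.assoc)
      also have "\<dots> = (\<Sum>b\<in>exponents (\<delta> * D). (\<Sum>a<q. \<kappa> a * u a b) * monomial b x)"
        by (subst sum.swap) (simp add: sum_distrib_right)
      finally show ?thesis using k(2) by simp
    qed
    then show False using g(2) k(1) unfolding independent_family_def by blast
  qed
  \<comment> \<open>\<open>K\<close> is a value of \<open>D\<close> that refutes
    \<open>bound\<close>: the right side is then at most \<open>K * (K + 1) ^ m\<close>, the left
    side at least \<open>(K + 1) ^ (m + 1)\<close>.\<close>
  define K where "K = e ^ card Y * (\<delta> + 1) ^ m"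
  have le: "(K + 1) ^ l \<le> K * (K + 1) ^ m"
  proof -
    have "(K + 1) ^ l \<le> e ^ card Y * (\<delta> * K + 1) ^ m" by (rule bound)
    also have "\<dots> \<le> e ^ card Y * ((\<delta> + 1) * (K + 1)) ^ m"
      by (intro mult_left_mono power_mono) auto
    finally show ?thesis by (simp only: K_def power_mult_distrib mult.assoc)
  qed
  have "(K + 1) * (K + 1) ^ m \<le> (K + 1) ^ l"
    using not power_increasing[of "Suc m" l "K + 1"] by (simp add: m_def)
  then have "(K + 1) * (K + 1) ^ m \<le> K * (K + 1) ^ m" using le by linarith
  then show False by simp
qed

lemma algebraic_codim_ge: "enat (card Y) \<le> algebraic_codim n S"
proof (cases "S = {}")
  case False
  have "algebraic_dim n S \<le> enat (n - card Y)"
    unfolding algebraic_dim_def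
  proof (rule Sup_least)
    fix z assume "z \<in> {enat l | l. \<exists>C :: nat \<Rightarrow> (nat \<Rightarrow> real) set.
     (\<forall>i\<le>l. irreducible_algebraic n (C i) \<and> C i \<subseteq> S) \<and> (\<forall>i<l. C i \<subset> C (Suc i))}"
    then obtain l C where "z = enat l" "\<forall>i\<le>l. irreducible_algebraic n (C i) \<and> C i \<subseteq> S"
      "\<forall>i<l. C i \<subset> C (Suc i)" by blast
    then show "z \<le> enat (n - card Y)" using chain_length_le[of l C] by auto
  qed
  \<comment> \<open>Subtraction is truncated, so \<open>n - (n - card Y)\<close> equals
    \<open>card Y\<close> only under this bound.\<close>
  moreover have "card Y \<le> n" using card_mono[OF _ Y] by simp
  ultimately have "enat (card Y) \<le> enat n - algebraic_dim n S"
    by (cases "algebraic_dim n S") auto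
  then show ?thesis using False by (simp add: algebraic_codim_def)
qed (simp add: algebraic_codim_def)

end

section \<open>Eigenvalues\<close>

lemma det_eq_0_iff_kernel:
  fixes A :: "'a::field^'n^'n"
  shows "det A = 0 \<longleftrightarrow> (\<exists>v. v \<noteq> 0 \<and> A *v v = 0)"
  using invertible_det_nz[of A] invertible_left_inverse[of A] matrix_left_invertible_ker[of A] by blast

lemma mat_vector_mult: "mat e *v v = e *s (v :: 'a::comm_semiring_1^'n)"
  by (simp add: vec_eq_iff matrix_vector_mult_def mat_def if_distrib[of "\<lambda>u. u * _"] cong: if_cong)

lemma eigenvalue_of_iff_det:
  "eigenvalue_of A e \<longleftrightarrow> det (map_matrix of_real A - mat e) = 0"
  unfolding det_eq_0_iff_kernel eigenvalue_of_def
  by (simp add: matrix_vector_mult_diff_rdistrib mat_vector_mult)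

lemma det_of_real:
  "det (map_matrix of_real M :: complex^'m^'m) = of_real (det (M :: real^'m^'m))"
  by (simp add: det_def)

text \<open>The matrix of the operator \<open>X \<mapsto> X B - A X\<close> on square matrices.\<close>

definition sylvester :: "'a::comm_ring_1^'n^'n \<Rightarrow> 'a^'n^'n \<Rightarrow> 'a^('n \<times> 'n)^('n \<times> 'n)" where
  "sylvester A B = (\<chi> p q. (if fst p = fst q then B $ snd q $ snd p else 0) -
     (if snd p = snd q then A $ fst p $ fst q else 0))"

lemma sylvester_nth:
  "sylvester A B $ p $ q = (if fst p = fst q then B $ snd q $ snd p else 0) -
     (if snd p = snd q then A $ fst p $ fst q else 0)"
  by (simp add: sylvester_def)

lemma sylvester_of_real:
  "sylvester (map_matrix of_real A) (map_matrix of_real B) = (map_matrix of_real (sylvester A B) :: complex^_^_)"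
  by (simp add: vec_eq_iff sylvester_nth)

text \<open>Replacing \<open>B\<close> by \<open>t I + B\<close> adds \<open>t X\<close> to
  \<open>X B - A X\<close>. The determinant thus becomes a characteristic polynomial in
  \<open>t\<close>, monic by \<open>charpoly_monic\<close>.\<close>

lemma sylvester_shift:
  "sylvester A (t *\<^sub>R mat 1 + B) = t *\<^sub>R mat 1 + sylvester A (B :: real^'n^'n)"
  by (auto simp: vec_eq_iff sylvester_nth mat_def prod_eq_iff)

text \<open>This is \<open>X B - A X = v (B^T w)^T - (A v) w^T\<close> for the rank-one matrix
  \<open>X = v w^T\<close>.\<close>

lemma sylvester_mult_outer:
  fixes v w :: "'a::comm_ring_1^'n"
  shows "(sylvester A B *v (\<chi> p. v $ fst p * w $ snd p)) $ (i, j) =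
     v $ i * (transpose B *v w) $ j - (A *v v) $ i * w $ j"
proof -
  have "(sylvester A B *v (\<chi> p. v $ fst p * w $ snd p)) $ (i, j) =
     (\<Sum>k\<in>UNIV. \<Sum>l\<in>UNIV. sylvester A B $ (i, j) $ (k, l) * (v $ k * w $ l))"
    by (simp add: matrix_vector_mult_def sum.cartesian_product case_prod_beta flip: UNIV_Times_UNIV)
  also have "\<dots> = (\<Sum>k\<in>UNIV. \<Sum>l\<in>UNIV. (if i = k then B $ l $ j * (v $ k * w $ l) else 0)) -
     (\<Sum>k\<in>UNIV. \<Sum>l\<in>UNIV. (if j = l then A $ i $ k * (v $ k * w $ l) else 0))"
    by (simp add: sylvester_nth left_diff_distrib sum_subtractf if_distrib[of "\<lambda>u. u * _"] cong: if_cong)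
  also have "(\<Sum>k\<in>UNIV. \<Sum>l\<in>UNIV. (if i = k then B $ l $ j * (v $ k * w $ l) else 0)) =
      v $ i * (\<Sum>l\<in>UNIV. B $ l $ j * w $ l)"
    by (subst sum.swap) (simp add: sum_distrib_left ac_simps)
  also have "(\<Sum>k\<in>UNIV. \<Sum>l\<in>UNIV. (if j = l then A $ i $ k * (v $ k * w $ l) else 0)) =
      (\<Sum>k\<in>UNIV. A $ i $ k * v $ k) * w $ j"
    by (simp add: sum_distrib_right mult.assoc)
  finally show ?thesis
    by (simp only: matrix_vector_mult_def transpose_def vec_lambda_beta)
qed

text \<open>With a right eigenvector \<open>v\<close> of \<open>A\<close> and a left eigenvector
  \<open>w\<close> of \<open>B\<close>, the nonzero matrix \<open>X = v w^T\<close> satisfies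
  \<open>A X = e X = X B\<close>. As \<open>e\<close> may be complex, the kernel is found over the
  complex numbers; the determinant itself is real.\<close>

lemma common_eigenvalue_imp_det_sylvester:
  assumes A: "eigenvalue_of A e" and B: "eigenvalue_of B e"
  shows "det (sylvester A B) = 0"
proof -
  define A' B' :: "complex^'a^'a" where "A' = map_matrix of_real A" and "B' = map_matrix of_real B"
  obtain v where v: "v \<noteq> 0" "A' *v v = e *s v"
    using A unfolding eigenvalue_of_def A'_def by auto
  \<comment> \<open>A matrix and its transpose share their eigenvalues, which yields the left
    eigenvector \<open>w\<close>.\<close>
  have "transpose (B' - mat e) = transpose B' - mat e"
    by (auto simp: vec_eq_iff transpose_def mat_def)
  moreover have "det (transpose (B' - mat e)) = 0"
    using B unfolding eigenvalue_of_iff_det B'_def det_transpose by simp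
  ultimately obtain w where w: "w \<noteq> 0" "(transpose B' - mat e) *v w = 0"
    using det_eq_0_iff_kernel by metis
  then have w': "transpose B' *v w = e *s w"
    by (simp add: matrix_vector_mult_diff_rdistrib mat_vector_mult del: transpose_matrix_vector)
  define X where "X = (\<chi> p. v $ fst p * w $ snd p)"
  have "(sylvester A' B' *v X) $ (i, j) = 0" for i j
    unfolding X_def sylvester_mult_outer v w' by simp
  then have "sylvester A' B' *v X = 0" by (simp add: vec_eq_iff split_paired_all)
  moreover obtain i j where "v $ i \<noteq> 0" "w $ j \<noteq> 0" using v(1) w(1) by (auto simp: vec_eq_iff)
  then have "X $ (i, j) \<noteq> 0" by (simp add: X_def)
  then have "X \<noteq> 0" by auto
  ultimately have "det (sylvester A' B') = 0" using det_eq_0_iff_kernel by blast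
  then show ?thesis unfolding A'_def B'_def sylvester_of_real det_of_real by simp
qed

text \<open>Every such \<open>t\<close> is a root of a monic polynomial, the determinant of the
  shifted operator.\<close>

lemma finite_common_eigenvalue_shift:
  fixes A B :: "real^'n^'n"
  shows "finite {t. \<exists>e. eigenvalue_of A e \<and> eigenvalue_of (t *\<^sub>R mat 1 + B) e}"
proof -
  let ?N = "CARD('n \<times> 'n)"
  \<comment> \<open>Only \<open>t\<close> varies here, so the parameter type is \<open>unit\<close>
    and every function is admissible as a coefficient.\<close>
  obtain c :: "nat \<Rightarrow> unit \<Rightarrow> real" where
    c: "\<And>x t. det (t *\<^sub>R mat 1 + sylvester A B) = t ^ ?N + (\<Sum>j<?N. c j x * t ^ j)"
  proof (rule charpoly_monic[of "\<lambda>_. True" "\<lambda>_. sylvester A B"])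
    fix c :: "nat \<Rightarrow> unit \<Rightarrow> real"
    assume "\<And>x t. det (t *\<^sub>R mat 1 + sylvester A B) = t ^ ?N + (\<Sum>j<?N. c j x * t ^ j)"
    then show thesis by (rule that)
  qed simp_all
  define a where "a = (\<lambda>j. if j = ?N then 1 else c j ())"
  have "det (t *\<^sub>R mat 1 + sylvester A B) = (\<Sum>j\<le>?N. a j * t ^ j)" for t
    unfolding c[of t "()"] lessThan_Suc_atMost[symmetric] by (simp add: a_def)
  moreover have "finite {t. (\<Sum>j\<le>?N. a j * t ^ j) = 0}"
    unfolding polyfun_finite_roots by (auto simp: a_def)
  ultimately show ?thesis
    using common_eigenvalue_imp_det_sylvester[of A _ "_ *\<^sub>R mat 1 + B"]
    by (elim rev_finite_subset) (auto simp: sylvester_shift)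
qed

section \<open>Bounds and limits of eigenvalues\<close>

text \<open>The eigenvalue equation is read at a coordinate where the eigenvector has largest
  modulus. The bound supplies compactness in the proof of openness.\<close>

lemma eigenvalue_norm_le:
  fixes A :: "real^'n^'n"
  assumes "eigenvalue_of A e"
  shows "norm e \<le> real CARD('n) * norm A"
proof -
  obtain v :: "complex^'n" where v: "v \<noteq> 0" "map_matrix of_real A *v v = e *s v"
    using assms unfolding eigenvalue_of_def by auto
  obtain i where i: "\<And>j. norm (v $ j) \<le> norm (v $ i)"
  proof -
    have "Max (range (\<lambda>j. norm (v $ j))) \<in> range (\<lambda>j. norm (v $ j))" by (intro Max_in) auto
    then obtain i where i: "Max (range (\<lambda>j. norm (v $ j))) = norm (v $ i)" by (rule imageE)
    have "norm (v $ j) \<le> norm (v $ i)" for j unfolding i[symmetric] by (intro Max_ge) auto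
    then show thesis using that by blast
  qed
  have pos: "norm (v $ i) > 0"
  proof (rule ccontr)
    assume "\<not> norm (v $ i) > 0"
    then have "v $ j = 0" for j using i[of j] norm_le_zero_iff by fastforce
    then show False using v(1) by (simp add: vec_eq_iff)
  qed
  have "norm e * norm (v $ i) = norm ((map_matrix of_real A *v v) $ i)"
    unfolding v(2) by (simp add: norm_mult)
  also have "\<dots> \<le> (\<Sum>j\<in>UNIV. norm (of_real (A $ i $ j) * v $ j))"
    unfolding matrix_vector_mult_def by (simp only: vec_lambda_beta nth_map_matrix norm_sum)
  also have "\<dots> \<le> (\<Sum>j\<in>(UNIV::'n set). norm A * norm (v $ i))"
  proof (rule sum_mono)
    fix j
    have "\<bar>A $ i $ j\<bar> \<le> norm A"
      using component_le_norm_cart[of "A $ i" j] Finite_Cartesian_Product.norm_nth_le[of A i] by linarith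
    then show "norm (of_real (A $ i $ j) * v $ j) \<le> norm A * norm (v $ i)"
      by (simp add: norm_mult mult_mono i)
  qed
  finally show ?thesis using pos by (simp add: mult.assoc[symmetric])
qed

text \<open>The determinant of \<open>U k - e k\<close> is continuous in both arguments and zero for
  every \<open>k\<close>.\<close>

lemma eigenvalue_limit:
  fixes U :: "nat \<Rightarrow> real^'n^'n"
  assumes "U \<longlonglongrightarrow> A" "e \<longlonglongrightarrow> l" "\<And>k. eigenvalue_of (U k) (e k)"
  shows "eigenvalue_of A l"
proof -
  have "(\<lambda>k. det (map_matrix of_real (U k) - mat (e k) :: complex^'n^'n)) \<longlonglongrightarrow>
      det (map_matrix of_real A - mat l)"
    unfolding det_def mat_def using assms(1,2)
    by (auto intro!: tendsto_intros tendsto_sum tendsto_prod tendsto_vec_nth simp: if_distrib)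
  moreover have "(\<lambda>k. det (map_matrix of_real (U k) - mat (e k) :: complex^'n^'n)) = (\<lambda>k. 0)"
    using assms(3) by (simp add: eigenvalue_of_iff_det)
  ultimately show ?thesis unfolding eigenvalue_of_iff_det by (simp add: LIMSEQ_const_iff)
qed

section \<open>The space of analytic potentials\<close>

lemma holo_extension_add:
  assumes "holo_extension \<rho> V1 W1" "holo_extension \<rho> V2 W2"
  shows "holo_extension \<rho> (\<lambda>x. V1 x + V2 x) (\<lambda>z. W1 z + W2 z)"
  using assms unfolding holo_extension_def
  by (auto intro!: continuous_intros holomorphic_intros simp: vec_eq_iff)

lemma holo_extension_scale:
  assumes "holo_extension \<rho> V W"
  shows "holo_extension \<rho> (\<lambda>x. c *\<^sub>R V x) (\<lambda>z. c *\<^sub>R W z)"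
  using assms unfolding holo_extension_def
  by (auto intro!: continuous_intros holomorphic_intros simp: vec_eq_iff scaleR_conv_of_real[of _ "_ :: complex"])

lemma complexification_add:
  assumes "subspace E" "M \<in> complexification E" "N \<in> complexification E"
  shows "M + N \<in> complexification E"
proof -
  have "map_matrix Re (M + N) = map_matrix Re M + map_matrix Re N"
    "map_matrix Im (M + N) = map_matrix Im M + map_matrix Im N" by (simp_all add: vec_eq_iff)
  then show ?thesis using assms by (simp add: complexification_def subspace_add)
qed

lemma complexification_scale:
  assumes "subspace E" "M \<in> complexification E"
  shows "c *\<^sub>R M \<in> complexification E"
proof -
  have "map_matrix Re (c *\<^sub>R M) = c *\<^sub>R map_matrix Re M"
    "map_matrix Im (c *\<^sub>R M) = c *\<^sub>R map_matrix Im M" by (simp_all add: vec_eq_iff)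
  then show ?thesis using assms by (simp add: complexification_def subspace_scale)
qed

lemma Comega_add:
  assumes "subspace E" "V \<in> Comega \<rho> E" "W \<in> Comega \<rho> E"
  shows "(\<lambda>x. V x + W x) \<in> Comega \<rho> E"
proof -
  obtain F G where "holo_extension \<rho> V F" "\<forall>z\<in>annulus \<rho>. F z \<in> complexification E"
    "holo_extension \<rho> W G" "\<forall>z\<in>annulus \<rho>. G z \<in> complexification E"
    using assms unfolding Comega_def by blast
  moreover from this have "holo_extension \<rho> (\<lambda>x. V x + W x) (\<lambda>z. F z + G z)"
    by (intro holo_extension_add)
  ultimately show ?thesis
    using assms unfolding Comega_def by (auto simp: subspace_add intro!: complexification_add exI[of _ "\<lambda>z. F z + G z"])
qed

lemma Comega_scale:
  assumes "subspace E" "V \<in> Comega \<rho> E"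
  shows "(\<lambda>x. c *\<^sub>R V x) \<in> Comega \<rho> E"
proof -
  obtain F where "holo_extension \<rho> V F" "\<forall>z\<in>annulus \<rho>. F z \<in> complexification E"
    using assms unfolding Comega_def by blast
  moreover from this have "holo_extension \<rho> (\<lambda>x. c *\<^sub>R V x) (\<lambda>z. c *\<^sub>R F z)"
    by (intro holo_extension_scale)
  ultimately show ?thesis
    using assms unfolding Comega_def by (auto simp: subspace_scale intro!: complexification_scale exI[of _ "\<lambda>z. c *\<^sub>R F z"])
qed

text \<open>On the unit circle, \<open>cos (2 \<pi> x)\<close> is \<open>(z + 1/z) / 2\<close>.\<close>

lemma cosine_polynomial_in_Comega:
  fixes A :: "real^'n^'n" and p :: "real poly"
  assumes \<rho>: "0 < \<rho>" "\<rho> < 1" and E: "subspace E" "A \<in> E"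
  shows "(\<lambda>x. poly p (cos (2 * pi * x)) *\<^sub>R A) \<in> Comega \<rho> E"
proof -
  define G :: "complex \<Rightarrow> complex" where
    "G = (\<lambda>z. \<Sum>i\<le>degree p. of_real (coeff p i) * ((z + inverse z) / 2) ^ i)"
  define W where "W = (\<lambda>z. map_matrix (\<lambda>a. G z * of_real a) A)"
  have nz: "z \<noteq> 0" if "z \<in> annulus \<rho>" for z using that \<rho> by (auto simp: annulus_def)
  have cont: "continuous_on (annulus \<rho>) G"
    unfolding G_def using nz by (intro continuous_intros) auto
  have "0 \<notin> interior (annulus \<rho>)" using nz interior_subset by blast
  then have hol: "G holomorphic_on interior (annulus \<rho>)"
    unfolding G_def by (intro holomorphic_intros) auto
  have val: "G (exp (2 * of_real pi * \<i> * of_real x)) = of_real (poly p (cos (2 * pi * x)))" for x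
  proof -
    have "exp (2 * of_real pi * \<i> * of_real x) + inverse (exp (2 * of_real pi * \<i> * of_real x)) =
        2 * cos (of_real (2 * pi * x) :: complex)"
      by (simp add: cos_exp_eq exp_minus ac_simps)
    then show ?thesis unfolding G_def by (simp add: poly_altdef flip: cos_of_real)
  qed
  have "holo_extension \<rho> (\<lambda>x. poly p (cos (2 * pi * x)) *\<^sub>R A) W"
    unfolding holo_extension_def
  proof (intro conjI allI)
    show "continuous_on (annulus \<rho>) W"
      unfolding W_def map_matrix_def by (intro continuous_intros continuous_on_vec_lambda cont)
    show "(\<lambda>z. W z $ i $ j) holomorphic_on interior (annulus \<rho>)" for i j
      unfolding W_def nth_map_matrix by (intro holomorphic_intros hol)
    show "W (exp (2 * of_real pi * \<i> * of_real x)) =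
        map_matrix of_real (poly p (cos (2 * pi * x)) *\<^sub>R A)" for x
      unfolding W_def val by (simp add: vec_eq_iff)
  qed
  moreover have "W z \<in> complexification E" for z
  proof -
    have "map_matrix Re (W z) = Re (G z) *\<^sub>R A" "map_matrix Im (W z) = Im (G z) *\<^sub>R A"
      by (simp_all add: vec_eq_iff W_def)
    then show ?thesis using E by (simp add: complexification_def subspace_scale)
  qed
  moreover have "cos (2 * pi * (x + 1)) = cos (2 * pi * x)" for x
    using cos_periodic[of "2 * pi * x"] by (simp add: distrib_left)
  ultimately show ?thesis using E unfolding Comega_def by (auto simp: subspace_scale)
qed

lemma Comega_sum:
  assumes "0 < \<rho>" "\<rho> < 1" "subspace E" "\<And>i. i \<in> I \<Longrightarrow> V i \<in> Comega \<rho> E"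
  shows "(\<lambda>x. \<Sum>i\<in>I. V i x) \<in> Comega \<rho> E"
proof -
  have "(\<lambda>x. 0) \<in> Comega \<rho> E"
    using cosine_polynomial_in_Comega[of \<rho> E 0 0] assms by (simp add: subspace_0)
  then show ?thesis using assms(4)
    by (induction I rule: infinite_finite_induct) (auto intro: Comega_add[OF assms(3)])
qed

text \<open>The unit circle lies in the annulus, and there the extensions take the values of the
  potentials themselves. This makes evaluation at a point continuous.\<close>

lemma norm_diff_le_Comega_dist:
  assumes \<rho>: "0 < \<rho>" "\<rho> < 1" and V: "V \<in> Comega \<rho> E" "W \<in> Comega \<rho> E"
  shows "norm (V x - W x) \<le> Comega_dist \<rho> E V W"
proof -
  obtain F G where FG: "holo_extension \<rho> V F" "holo_extension \<rho> W G"
    using V unfolding Comega_def by blast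
  let ?z = "exp (2 * of_real pi * \<i> * of_real x) :: complex"
  have "norm ?z = 1" by (simp add: norm_exp_eq_Re)
  then have z: "?z \<in> annulus \<rho>" using \<rho> by (auto simp: annulus_def)
  have "F ?z - G ?z = map_matrix of_real (V x - W x)"
    using FG unfolding holo_extension_def by (simp add: vec_eq_iff)
  moreover have "norm (map_matrix of_real M :: complex^'a^'a) = norm M" for M :: "real^'a^'a"
    by (simp add: norm_vec_def)
  ultimately have "norm (V x - W x) = norm (F ?z - G ?z)" by simp
  also have "\<dots> \<le> Comega_norm \<rho> (\<lambda>x. V x - W x)"
    by (rule norm_extension_le[OF \<rho> holo_extension_diff[OF FG] z])
  finally show ?thesis using V by (simp add: Comega_dist_def)
qed

section \<open>Evaluation maps, openness and density\<close>

lemma topspace_Comega: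
  assumes "0 < \<rho>" "\<rho> < 1"
  shows "topspace (Comega_topology \<rho> E) = Comega \<rho> E"
  unfolding Comega_topology_def using Metric_space.topspace_mtopology[OF Metric_space_Comega[OF assms]] .

lemma continuous_map_evaluation:
  assumes \<rho>: "0 < \<rho>" "\<rho> < 1"
  shows "continuous_map (Comega_topology \<rho> E) euclidean (\<lambda>V. V x)"
proof -
  interpret Metric_space "Comega \<rho> E" "Comega_dist \<rho> E" by (rule Metric_space_Comega[OF \<rho>])
  have "continuous_map mtopology (Metric_space.mtopology UNIV dist) (\<lambda>V. V x)"
    unfolding metric_continuous_map[OF Met_TC.Metric_space_axioms]
  proof (intro conjI ballI allI impI)
    fix V \<epsilon> assume V: "V \<in> Comega \<rho> E" and "(\<epsilon>::real) > 0"
    moreover have "dist (V x) (U x) < \<epsilon>" if "U \<in> Comega \<rho> E" "Comega_dist \<rho> E V U < \<epsilon>" for U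
      using norm_diff_le_Comega_dist[OF \<rho> V that(1), of x] that by (simp add: dist_norm)
    ultimately show "\<exists>\<delta>>0. \<forall>U. U \<in> Comega \<rho> E \<and> Comega_dist \<rho> E V U < \<delta> \<longrightarrow> dist (V x) (U x) < \<epsilon>"
      by blast
  qed auto
  then show ?thesis by (simp add: Comega_topology_def)
qed

text \<open>Otherwise potentials \<open>U k\<close> with constant eigenvalues \<open>e k\<close>
  converge to \<open>V\<close>. A subsequence of the \<open>e k\<close> converges, and its limit is
  an eigenvalue of \<open>V x\<close> for every \<open>x\<close>.\<close>

lemma openin_no_constant_eigenvalues:
  fixes E :: "(real^'n^'n) set"
  assumes \<rho>: "0 < \<rho>" "\<rho> < 1"
  shows "openin (Comega_topology \<rho> E) {V \<in> Comega \<rho> E. no_constant_eigenvalues V}"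
proof -
  interpret Metric_space "Comega \<rho> E" "Comega_dist \<rho> E" by (rule Metric_space_Comega[OF \<rho>])
  show ?thesis
    unfolding Comega_topology_def openin_mtopology
  proof (intro conjI allI impI)
    fix V assume "V \<in> {V \<in> Comega \<rho> E. no_constant_eigenvalues V}"
    then have V: "V \<in> Comega \<rho> E" "no_constant_eigenvalues V" by auto
    show "\<exists>r>0. mball V r \<subseteq> {V \<in> Comega \<rho> E. no_constant_eigenvalues V}"
    proof (rule ccontr)
      assume "\<not> ?thesis"
      then have sub: "\<not> mball V r \<subseteq> {V \<in> Comega \<rho> E. no_constant_eigenvalues V}" if "r > 0" for r
        using that by blast
      have "\<exists>U. U \<in> mball V (inverse (real (Suc k))) \<and> \<not> no_constant_eigenvalues U" for k
        using sub[of "inverse (real (Suc k))"] mball_subset_mspace by fastforce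
      then obtain U where U: "\<And>k. U k \<in> mball V (inverse (real (Suc k)))"
        "\<And>k. \<not> no_constant_eigenvalues (U k)" by metis
      then obtain e where e: "\<And>k x. eigenvalue_of (U k x) (e k)"
        unfolding no_constant_eigenvalues_def by metis
      have close: "norm (U k x - V x) < inverse (real (Suc k))" for k x
        using norm_diff_le_Comega_dist[OF \<rho> V(1), of "U k" x] U(1)[of k] by (simp add: norm_minus_commute)
      have lim: "(\<lambda>k. U k x) \<longlonglongrightarrow> V x" for x
      proof (rule Lim_null_comparison[THEN LIM_zero_cancel])
        show "\<forall>\<^sub>F k in sequentially. norm (U k x - V x) \<le> inverse (real (Suc k))"
          using close less_imp_le by (intro always_eventually) blast
        show "(\<lambda>k. inverse (real (Suc k))) \<longlonglongrightarrow> 0" by (rule LIMSEQ_inverse_real_of_nat)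
      qed
      \<comment> \<open>Since \<open>e k\<close> is a constant eigenvalue, a bound at the single
        point \<open>0\<close> suffices.\<close>
      have "norm (e k) \<le> real CARD('n) * (norm (V 0) + 1)" for k
      proof -
        have "norm (U k 0) \<le> norm (V 0) + norm (U k 0 - V 0)" by (metis norm_triangle_sub)
        also have "norm (U k 0 - V 0) \<le> 1"
          using close[of k 0] inverse_le_1_iff[of "real (Suc k)"] by simp
        finally show ?thesis using eigenvalue_norm_le[OF e[of k 0]]
          by (meson add_left_mono mult_left_mono of_nat_0_le_iff order_trans)
      qed
      then have "bounded (range e)" by (auto simp: bounded_iff)
      then obtain l r where r: "strict_mono r" "(e \<circ> r) \<longlonglongrightarrow> l"
        using bounded_imp_convergent_subsequence by blast
      have "eigenvalue_of (V x) l" for x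
        using eigenvalue_limit[OF LIMSEQ_subseq_LIMSEQ[OF lim r(1)] r(2)] e by (simp add: comp_def)
      then show False using V(2) unfolding no_constant_eigenvalues_def by blast
    qed
  qed auto
qed

lemma no_constant_eigenvalues_dense:
  fixes E :: "(real^'n^'n) set"
  assumes \<rho>: "0 < \<rho>" "\<rho> < 1" and E: "subspace E" "mat 1 \<in> E"
  shows "Comega_topology \<rho> E closure_of {V \<in> Comega \<rho> E. no_constant_eigenvalues V} = Comega \<rho> E"
proof -
  interpret Metric_space "Comega \<rho> E" "Comega_dist \<rho> E" by (rule Metric_space_Comega[OF \<rho>])
  \<comment> \<open>The polynomial is \<open>(1 - y) / 2\<close> at
    \<open>y = cos (2 * pi * x)\<close>: \<open>g\<close> is zero at \<open>0\<close> and the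
    identity at \<open>1/2\<close>.\<close>
  define g where "g = (\<lambda>x. poly [:1/2, -1/2:] (cos (2 * pi * x)) *\<^sub>R (mat 1 :: real^'n^'n))"
  have g: "g \<in> Comega \<rho> E" unfolding g_def by (rule cosine_polynomial_in_Comega[OF \<rho> E])
  obtain G where G: "holo_extension \<rho> g G" using g unfolding Comega_def by blast
  have "\<exists>U\<in>{V \<in> Comega \<rho> E. no_constant_eigenvalues V}. U \<in> mball V r" if V: "V \<in> Comega \<rho> E" and r: "r > 0" for V r
  proof -
    \<comment> \<open>The size of the perturbation \<open>t * g\<close> is at most
      \<open>t * M\<close>. The later division by \<open>M + 1\<close> keeps the denominator
      positive even for \<open>M = 0\<close>.\<close>
    define M where "M = Comega_norm \<rho> g"
    have "norm (G 1) \<le> M"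
      unfolding M_def using \<rho> by (intro norm_extension_le[OF \<rho> G]) (auto simp: annulus_def)
    then have M: "M \<ge> 0" using norm_ge_zero order_trans by blast
    define T where "T = {t. \<exists>e. eigenvalue_of (V 0) e \<and> eigenvalue_of (t *\<^sub>R mat 1 + V (1/2)) e}"
    have "infinite ({0<..<r / (M + 1)} - T)"
      using finite_common_eigenvalue_shift M r unfolding T_def
      by (intro Diff_infinite_finite infinite_Ioo) auto
    then have "{0<..<r / (M + 1)} - T \<noteq> {}" by (rule infinite_imp_nonempty)
    then obtain t where "t \<in> {0<..<r / (M + 1)} - T" by (meson ex_in_conv)
    then have t: "0 < t" "t < r / (M + 1)" "t \<notin> T" by auto
    define U where "U = (\<lambda>x. V x + t *\<^sub>R g x)"
    have U: "U \<in> Comega \<rho> E" unfolding U_def by (intro Comega_add Comega_scale E V g)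
    have "U 0 = V 0" "U (1/2) = t *\<^sub>R mat 1 + V (1/2)" by (simp_all add: U_def g_def)
    then have "t \<in> T" if "\<And>x. eigenvalue_of (U x) e" for e
      using that[of 0] that[of "1/2"] by (auto simp: T_def)
    then have "no_constant_eigenvalues U"
      using t(3) unfolding no_constant_eigenvalues_def by blast
    moreover have "Comega_dist \<rho> E V U < r"
    proof -
      obtain F where F: "holo_extension \<rho> V F" using V unfolding Comega_def by blast
      have "holo_extension \<rho> (\<lambda>x. V x - U x) (\<lambda>z. F z - (F z + t *\<^sub>R G z))"
        unfolding U_def by (intro holo_extension_diff holo_extension_add holo_extension_scale F G)
      then have "Comega_norm \<rho> (\<lambda>x. V x - U x) \<le> t * M"
        by (rule Comega_norm_le[OF \<rho>]) (use t norm_extension_le[OF \<rho> G] in \<open>simp add: M_def\<close>)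
      also have "\<dots> \<le> t * (M + 1)" using t by simp
      also have "\<dots> < r" using t M by (simp add: pos_less_divide_eq)
      finally show ?thesis using U V by (simp add: Comega_dist_def)
    qed
    ultimately show ?thesis using U V by auto
  qed
  then show ?thesis unfolding Comega_topology_def metric_closure_of by auto
qed

section \<open>Coordinates, interpolation and the subvarieties\<close>

text \<open>A basis of \<open>E\<close> is extended from \<open>u\<close> and listed with
  \<open>u\<close> first; the dual functionals extend linearly to the whole space. With
  \<open>u\<close> the identity matrix, coordinate \<open>0\<close> is the one shifted in
  \<open>sylvester_shift\<close>.\<close>

lemma subspace_coordinates:
  fixes E :: "'a::euclidean_space set"
  assumes E: "subspace E" "u \<in> E" "u \<noteq> 0"
  obtains m b \<phi> where "m > (0::nat)" "b 0 = u" "\<And>q. q < m \<Longrightarrow> b q \<in> E"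
    "\<And>q. linear (\<phi> q :: 'a \<Rightarrow> real)"
    "\<And>q r. q < m \<Longrightarrow> r < m \<Longrightarrow> \<phi> q (b r) = (if r = q then 1 else 0)"
    "\<And>A. A \<in> E \<Longrightarrow> A = (\<Sum>q<m. \<phi> q A *\<^sub>R b q)"
proof -
  obtain B where B: "{u} \<subseteq> B" "B \<subseteq> E" "independent B" "E \<subseteq> span B"
    by (rule maximal_independent_subset_extend[of "{u}" E]) (use E in auto)
  have "finite (B - {u})" using B(3) independent_imp_finite by blast
  then obtain xs where xs: "set xs = B - {u}" "distinct xs" using finite_distinct_list by blast
  define m where "m = length (u # xs)"
  define b where "b = (!) (u # xs)"
  have dist: "distinct (u # xs)" and set: "set (u # xs) = B" using xs B(1) by auto
  have bB: "b q \<in> B" if "q < m" for q using that set nth_mem unfolding b_def m_def by metis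
  have ex: "\<exists>f. linear f \<and> (\<forall>x\<in>B. f x = (if x = b q then 1 else 0 :: real))" for q
    by (rule linear_independent_extend[OF B(3)])
  then obtain \<phi> where \<phi>: "\<And>q. linear (\<phi> q)" "\<And>q x. x \<in> B \<Longrightarrow> \<phi> q x = (if x = b q then 1 else 0 :: real)"
    by metis
  have dual: "\<phi> q (b r) = (if r = q then 1 else 0)" if "q < m" "r < m" for q r
    using that \<phi>(2)[OF bB] nth_eq_iff_index_eq[OF dist] unfolding b_def m_def by auto
  have rep: "A = (\<Sum>q<m. \<phi> q A *\<^sub>R b q)" if A: "A \<in> E" for A
  proof (rule linear_eq_on_span[of "\<lambda>A. A" "\<lambda>A. \<Sum>q<m. \<phi> q A *\<^sub>R b q" B A])
    show "linear (\<lambda>A :: 'a. A)" by (rule linear_ident)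
    show "linear (\<lambda>A. \<Sum>q<m. \<phi> q A *\<^sub>R b q)"
      by (intro linearI)
        (simp_all add: linear_add[OF \<phi>(1)] linear_scale[OF \<phi>(1)] scaleR_add_left sum.distrib scaleR_sum_right)
    show "A \<in> span B" using A B(4) by auto
    fix x assume "x \<in> B"
    then obtain r where r: "r < m" "x = b r" unfolding set[symmetric] b_def m_def by (metis in_set_conv_nth)
    have "(\<Sum>q<m. \<phi> q x *\<^sub>R b q) = (\<Sum>q<m. if q = r then b q else 0)"
      by (intro sum.cong) (auto simp: r dual)
    then show "x = (\<Sum>q<m. \<phi> q x *\<^sub>R b q)" using r by simp
  qed
  show thesis
    by (rule that[of m b \<phi>, OF _ _ _ \<phi>(1) dual rep]) (use bB B(2) in \<open>auto simp: m_def b_def\<close>)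
qed

text \<open>The product of the linear factors vanishing at the other nodes is normalised at its own
  node.\<close>

lemma lagrange_polynomial:
  fixes c :: "'i \<Rightarrow> real"
  assumes "finite I" "inj_on c I"
  obtains L where "\<And>i j. i \<in> I \<Longrightarrow> j \<in> I \<Longrightarrow> poly (L i) (c j) = (if i = j then 1 else 0)"
proof -
  define Q where "Q = (\<lambda>i. \<Prod>j\<in>I - {i}. [:- c j, 1:])"
  have "poly (smult (1 / poly (Q i) (c i)) (Q i)) (c j) = (if i = j then 1 else 0)" if "i \<in> I" "j \<in> I" for i j
    using assms that by (auto simp: Q_def poly_prod inj_on_def)
  then show thesis by (rule that)
qed

text \<open>The epimorphism records the coordinates of \<open>V\<close> at \<open>k + 1\<close>
  points. Comparing the point numbered \<open>0\<close> with each other one gives \<open>k\<close>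
  equations, and \<open>algebraic_codim_ge\<close> bounds the codimension of their zero set.\<close>

lemma constant_eigenvalues_in_subvariety:
  fixes E :: "(real^'n^'n) set"
  assumes \<rho>: "0 < \<rho>" "\<rho> < 1" and E: "subspace E" "mat 1 \<in> E"
  shows "\<exists>\<Sigma> c. algebraic_subvariety_of_codim (Comega_topology \<rho> E) \<Sigma> c \<and> enat k \<le> c \<and>
    {V \<in> Comega \<rho> E. \<not> no_constant_eigenvalues V} \<subseteq> \<Sigma>"
proof -
  have "mat 1 \<noteq> (0 :: real^'n^'n)" by (simp add: vec_eq_iff mat_def)
  then obtain m :: nat and b and \<phi> where m: "m > 0" and b: "b 0 = (mat 1 :: real^'n^'n)" "\<And>q. q < m \<Longrightarrow> b q \<in> E"
    and \<phi>: "\<And>q. linear (\<phi> q :: real^'n^'n \<Rightarrow> real)"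
      "\<And>q r. q < m \<Longrightarrow> r < m \<Longrightarrow> \<phi> q (b r) = (if r = q then 1 else 0)"
      "\<And>A. A \<in> E \<Longrightarrow> A = (\<Sum>q<m. \<phi> q A *\<^sub>R b q)"
    by (rule subspace_coordinates[OF E]) (rule that, assumption+)
  define n where "n = (k + 1) * m"
  \<comment> \<open>Index \<open>p * m + q\<close> holds coordinate \<open>q\<close> of the matrix
    at point \<open>p\<close>; hence \<open>p * m\<close> is its coordinate along the
    identity.\<close>
  define A where "A = (\<lambda>p (x :: nat \<Rightarrow> real). \<Sum>q<m. x (p * m + q) *\<^sub>R b q)"
  \<comment> \<open>Without its identity coordinate, the matrix at point \<open>p\<close> is free of
    the variables in \<open>Y\<close>.\<close>
  define A' where "A' = (\<lambda>p (x :: nat \<Rightarrow> real). \<Sum>q\<in>{1..<m}. x (p * m + q) *\<^sub>R b q)"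
  \<comment> \<open>The range starts at \<open>1\<close>: \<open>A 0\<close> occurs in the
    coefficients of every equation, so its identity coordinate must stay outside
    \<open>Y\<close>.\<close>
  define Y where "Y = (\<lambda>p. p * m) ` {1..k}"
  have split: "A p x = x (p * m) *\<^sub>R mat 1 + A' p x" for p x
  proof -
    have "{..<m} = insert 0 {1..<m}" using m by auto
    then show ?thesis by (simp add: A_def A'_def b)
  qed
  have idx: "p * m + q < n" if "p \<le> k" "q < m" for p q
  proof -
    have "p * m + q < (p + 1) * m" using that by simp
    also have "\<dots> \<le> n" unfolding n_def using that by (intro mult_right_mono) auto
    finally show ?thesis .
  qed
  have idxY: "p * m + q \<notin> Y" if "q < m" "p = 0 \<or> q \<noteq> 0" for p q
  proof
    assume "p * m + q \<in> Y"
    then obtain r where r: "r \<ge> 1" "p * m + q = r * m" by (auto simp: Y_def)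
    then have "q = 0" using that(1) by (metis mod_less mod_mult_self3 mod_mult_self2_is_0)
    then show False using r m that(2) by auto
  qed
  define J where "J = {..<n} - Y"
  have QA: "polynomial_in J (\<lambda>x. A 0 x $ i $ j)" for i j
    unfolding A_def sum_component vector_scaleR_component real_scaleR_def J_def
    using idx[of 0] idxY[of _ 0]
    by (intro polynomial_in_sum polynomial_in.mult polynomial_in.const polynomial_in.coord) auto
  have QA': "polynomial_in J (\<lambda>x. A' p x $ i $ j)" if "p \<le> k" for p i j
    unfolding A'_def sum_component vector_scaleR_component real_scaleR_def J_def
    using idx[of p] idxY[of _ p] that
    by (intro polynomial_in_sum polynomial_in.mult polynomial_in.const polynomial_in.coord) auto
  have QM: "polynomial_in J (\<lambda>x. sylvester (A 0 x) (A' p x) $ r $ s)" if "p \<le> k" for p r s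
    unfolding sylvester_nth
    by (cases "fst r = fst s"; cases "snd r = snd s")
      (auto intro!: polynomial_in_diff QA QA'[OF that] polynomial_in.const simp del: diff_0 diff_0_right)
  define N where "N = CARD('n \<times> 'n)"
  have "\<exists>c. (\<forall>j. polynomial_in J (c j)) \<and> (\<forall>x t. det (t *\<^sub>R mat 1 + sylvester (A 0 x) (A' p x)) =
      t ^ N + (\<Sum>j<N. c j x * t ^ j))" if "p \<le> k" for p
  proof (rule charpoly_monic[of "polynomial_in J" "\<lambda>x. sylvester (A 0 x) (A' p x)",
        OF polynomial_in.const polynomial_in.add polynomial_in.mult QM[OF that]])
    fix c :: "nat \<Rightarrow> (nat \<Rightarrow> real) \<Rightarrow> real"
    assume "\<And>j. polynomial_in J (c j)" "\<And>x t. det (t *\<^sub>R mat 1 + sylvester (A 0 x) (A' p x)) =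
      t ^ CARD('n \<times> 'n) + (\<Sum>j<CARD('n \<times> 'n). c j x * t ^ j)"
    then show ?thesis unfolding N_def by (intro exI[of _ c] conjI allI)
  qed
  then have "\<forall>p. \<exists>c. p \<le> k \<longrightarrow> (\<forall>j. polynomial_in J (c j)) \<and>
      (\<forall>x t. det (t *\<^sub>R mat 1 + sylvester (A 0 x) (A' p x)) = t ^ N + (\<Sum>j<N. c j x * t ^ j))"
    by auto
  from choice[OF this] obtain c where c_all: "\<forall>p. p \<le> k \<longrightarrow> (\<forall>j. polynomial_in J (c p j)) \<and>
      (\<forall>x t. det (t *\<^sub>R mat 1 + sylvester (A 0 x) (A' p x)) = t ^ N + (\<Sum>j<N. c p j x * t ^ j))"
    by (rule exE)
  have c: "polynomial_in J (c p j)"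
    "det (t *\<^sub>R mat 1 + sylvester (A 0 x) (A' p x)) = t ^ N + (\<Sum>j<N. c p j x * t ^ j)"
    if "p \<le> k" for p j x t
    using c_all[rule_format, OF that] by (simp_all only:)
  define f where "f = (\<lambda>p x. det (sylvester (A 0 x) (A p x)))"
  have f: "f p x = x (p * m) ^ N + (\<Sum>j<N. c p j x * x (p * m) ^ j)" if "p \<le> k" for p x
    unfolding f_def split[of p] sylvester_shift c(2)[OF that] ..
  have "polynomial_fun n (c p j)" if "p \<le> k" for p j
    using c(1)[OF that] by (rule polynomial_in_imp_polynomial_fun) (auto simp: J_def)
  then have poly_f: "polynomial_fun n (f p)" if "p \<le> k" for p
    unfolding f[OF that] using that idx[of p 0] m
    by (intro polynomial_fun.add polynomial_fun_sum polynomial_fun.mult polynomial_fun_power polynomial_fun.coord) auto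
  define S where "S = {x \<in> topspace (Euclidean_space n). \<forall>p\<in>{1..k}. f p x = 0}"
  have S: "algebraic_set n S"
    unfolding algebraic_set_def S_def using poly_f by (intro exI[of _ "f ` {1..k}"]) auto
  \<comment> \<open>For \<open>i = p * m\<close> in \<open>Y\<close>, \<open>i div m\<close>
    recovers the number \<open>p\<close> of the equation.\<close>
  interpret integral_variables n N Y S "\<lambda>i. c (i div m)"
  proof
    show "N > 0" by (simp add: N_def)
    show "Y \<subseteq> {..<n}" using idx[of _ 0] m by (auto simp: Y_def)
    show "x i ^ N + (\<Sum>j<N. c (i div m) j x * x i ^ j) = 0" if "i \<in> Y" "x \<in> S" for i x
      using that m f by (auto simp: Y_def S_def)
    show "polynomial_in ({..<n} - Y) (c (i div m) j)" if "i \<in> Y" for i j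
      using that m c(1) by (auto simp: Y_def J_def)
  qed
  have "card Y = k"
    unfolding Y_def using m by (subst card_image) (auto simp: inj_on_def)
  then have codim: "enat k \<le> algebraic_codim n S" using algebraic_codim_ge by simp

  \<comment> \<open>The angles \<open>2 * pi * pt p\<close> lie in \<open>[0, pi)\<close>, where the
    cosine is injective, so the cosines are distinct interpolation nodes.\<close>
  define pt where "pt = (\<lambda>p::nat. real p / (2 * real (k + 1)))"
  have "inj_on (\<lambda>p. cos (2 * pi * pt p)) {..k}"
  proof (rule inj_onI)
    fix p q assume pq: "p \<in> {..k}" "q \<in> {..k}" "cos (2 * pi * pt p) = cos (2 * pi * pt q)"
    have "0 \<le> 2 * pi * pt p" "2 * pi * pt p \<le> pi" if "p \<in> {..k}" for p
      using that mult_left_mono[of "pt p" "1 / 2" "2 * pi"] by (auto simp: pt_def divide_le_eq)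
    from cos_inj_pi[OF this[OF pq(1)] this[OF pq(2)] pq(3)] show "p = q"
      by (simp add: pt_def)
  qed
  from lagrange_polynomial[OF _ this] obtain L where
    L: "\<And>p q. p \<in> {..k} \<Longrightarrow> q \<in> {..k} \<Longrightarrow> poly (L p) (cos (2 * pi * pt q)) = (if p = q then 1 else 0)"
    by blast
  \<comment> \<open>Division by \<open>m\<close> gives the point and the remainder gives the
    coordinate; zero from index \<open>n\<close> on is what \<open>Euclidean_space n\<close>
    demands.\<close>
  define \<pi> where "\<pi> = (\<lambda>V :: real \<Rightarrow> real^'n^'n. \<lambda>i. if i < n then \<phi> (i mod m) (V (pt (i div m))) else 0)"
  let ?X = "Comega_topology \<rho> E"
  have top: "topspace ?X = Comega \<rho> E" by (rule topspace_Comega[OF \<rho>])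
  have \<pi>_top: "\<pi> V \<in> topspace (Euclidean_space n)" for V
    by (simp add: \<pi>_def topspace_Euclidean_space)
  have A_\<pi>: "A p (\<pi> V) = V (pt p)" if "V \<in> Comega \<rho> E" "p \<le> k" for V p
  proof -
    have "V (pt p) \<in> E" using that by (simp add: Comega_def)
    then have "V (pt p) = (\<Sum>q<m. \<phi> q (V (pt p)) *\<^sub>R b q)" by (rule \<phi>(3))
    also have "\<dots> = A p (\<pi> V)"
      unfolding A_def \<pi>_def using idx[OF that(2)] by (intro sum.cong) auto
    finally show ?thesis by simp
  qed
  have surj: "\<exists>V\<in>Comega \<rho> E. \<pi> V = x" if x: "x \<in> topspace (Euclidean_space n)" for x
  proof
    \<comment> \<open>Lagrange interpolation in \<open>cos (2 * pi * s)\<close>, with the matrices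
      \<open>A p x\<close> as prescribed values.\<close>
    define V where "V = (\<lambda>s. \<Sum>p\<in>{..k}. poly (L p) (cos (2 * pi * s)) *\<^sub>R A p x)"
    have "A p x \<in> E" for p
      unfolding A_def by (intro subspace_sum subspace_scale E b) auto
    then show "V \<in> Comega \<rho> E"
      unfolding V_def by (intro Comega_sum[OF \<rho> E(1)] cosine_polynomial_in_Comega[OF \<rho> E(1)])
    have V: "V (pt p) = A p x" if "p \<le> k" for p
    proof -
      have "V (pt p) = (\<Sum>r\<in>{..k}. if r = p then A r x else 0)"
        unfolding V_def using that by (intro sum.cong) (auto simp: L)
      then show ?thesis using that by simp
    qed
    show "\<pi> V = x"
    proof
      fix i
      show "\<pi> V i = x i"
      proof (cases "i < n")
        case True
        then have "i div m \<le> k" unfolding n_def using less_mult_imp_div_less[of i "k + 1" m] by simp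
        moreover have q: "i mod m < m" using m by simp
        ultimately have "\<pi> V i = (\<Sum>q<m. x (i div m * m + q) * \<phi> (i mod m) (b q))"
          using True by (simp add: \<pi>_def V A_def linear_sum[OF \<phi>(1)] linear_scale[OF \<phi>(1)])
        also have "\<dots> = (\<Sum>q<m. if q = i mod m then x (i div m * m + q) else 0)"
          using q by (intro sum.cong) (auto simp: \<phi>(2))
        also have "\<dots> = x i" using q by simp
        finally show ?thesis .
      next
        case False
        then show ?thesis using x by (simp add: \<pi>_def topspace_Euclidean_space)
      qed
    qed
  qed
  have "linear_epimorphism ?X n \<pi>"
    unfolding linear_epimorphism_def top
  proof (intro conjI ballI allI)
    show "\<pi> (\<lambda>x. V x + W x) = (\<lambda>i. \<pi> V i + \<pi> W i)" for V W
      by (auto simp: \<pi>_def linear_add[OF \<phi>(1)])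
    show "\<pi> (\<lambda>x. r *\<^sub>R V x) = (\<lambda>i. r * \<pi> V i)" for r V
      by (auto simp: \<pi>_def linear_scale[OF \<phi>(1)])
    show "\<pi> ` Comega \<rho> E = topspace (Euclidean_space n)"
      using surj \<pi>_top by blast
  qed
  moreover have "continuous_map ?X (Euclidean_space n) \<pi>"
    unfolding Euclidean_space_def continuous_map_in_subtopology continuous_map_componentwise_UNIV
  proof (intro conjI allI)
    show "continuous_map ?X euclideanreal (\<lambda>V. \<pi> V i)" for i
    proof (cases "i < n")
      case True
      have "continuous_map euclidean euclideanreal (\<phi> (i mod m))"
        by (simp add: linear_continuous_on linear_conv_bounded_linear[symmetric] \<phi>(1))
      from continuous_map_compose[OF continuous_map_evaluation[OF \<rho>, of E "pt (i div m)"] this]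
      show ?thesis using True by (simp add: \<pi>_def comp_def)
    next
      case False
      then show ?thesis by (simp add: \<pi>_def)
    qed
    show "\<pi> \<in> topspace ?X \<rightarrow> {x. \<forall>i\<ge>n. x i = 0}" by (auto simp: \<pi>_def)
  qed
  ultimately have "algebraic_subvariety_of_codim ?X {V \<in> topspace ?X. \<pi> V \<in> S} (algebraic_codim n S)"
    using S unfolding algebraic_subvariety_of_codim_def by blast
  moreover have "{V \<in> Comega \<rho> E. \<not> no_constant_eigenvalues V} \<subseteq> {V \<in> topspace ?X. \<pi> V \<in> S}"
  proof
    fix V assume "V \<in> {V \<in> Comega \<rho> E. \<not> no_constant_eigenvalues V}"
    then obtain e where V: "V \<in> Comega \<rho> E" and e: "\<And>x. eigenvalue_of (V x) e"
      unfolding no_constant_eigenvalues_def by blast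
    \<comment> \<open>The constant eigenvalue \<open>e\<close> is common to the values at
      \<open>pt 0\<close> and \<open>pt p\<close>.\<close>
    have "f p (\<pi> V) = 0" if "p \<in> {1..k}" for p
      using common_eigenvalue_imp_det_sylvester[OF e e, of "pt 0" "pt p"] A_\<pi>[OF V, of 0] A_\<pi>[OF V, of p] that
      by (simp add: f_def)
    then show "V \<in> {V \<in> topspace ?X. \<pi> V \<in> S}" using V \<pi>_top by (simp add: top S_def)
  qed
  ultimately show ?thesis using codim by blast
qed

theorem theorem3p1:
  fixes \<rho> :: real and E :: "(real^'n^'n) set" and \<V> :: "(real \<Rightarrow> real^'n^'n) set"
  assumes "0 < \<rho>" and "\<rho> < 1"
    and "E = UNIV \<or> E = {A. transpose A = A}"
    and "\<V> = {V \<in> Comega \<rho> E. no_constant_eigenvalues V}"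
  shows "(openin (Comega_topology \<rho> E) \<V> \<and>
          (Comega_topology \<rho> E) closure_of \<V> = Comega \<rho> E) \<and>
         (\<forall>k::nat. \<exists>\<Sigma> c. algebraic_subvariety_of_codim (Comega_topology \<rho> E) \<Sigma> c \<and>
            enat k \<le> c \<and> Comega \<rho> E - \<V> \<subseteq> \<Sigma>)"
proof -
  \<comment> \<open>Both choices of \<open>E\<close> enter only as linear subspaces containing the
    identity.\<close>
  have E: "subspace E" "mat 1 \<in> E"
    using assms(3) by (auto simp: subspace_def transpose_def vec_eq_iff mat_def)
  have "Comega \<rho> E - \<V> = {V \<in> Comega \<rho> E. \<not> no_constant_eigenvalues V}"
    using assms(4) by blast
  then show ?thesis
    using openin_no_constant_eigenvalues[OF assms(1,2), of E] no_constant_eigenvalues_dense[OF assms(1,2) E]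
      constant_eigenvalues_in_subvariety[OF assms(1,2) E]
    unfolding assms(4) by simp
qed

end
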